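(* Let $\lambda>0$, let $u_0\in H^s$ with $s>\frac32$, assume $u_0\not\equiv c$ for every $c\in\mathbb R$, and let $T$ be the maximal existence time of the solution $u$ to the weakly dissipative $\mu$HS equation with initial data $u_0$. Put $\mu_0=\int_{\mathbb S}u_0\,dx$, $\mu_1=\left(\int_{\mathbb S}u_{0,x}^2\,dx\right)^{1/2}$ and $$K=6|\mu_0|\mu_1^2\left(|\mu_0|+\tfrac{\sqrt3}{6}\mu_1\right).$$ If $$\int_{\mathbb S}u_{0,x}^3\,dx<-3\lambda\mu_1^2-\mu_1\sqrt{9\lambda^2\mu_1^2+2K},$$ then the corresponding solution blows up in finite time.
   Context: $\mathbb S=\mathbb R/\mathbb Z$; functions on $\mathbb S$ are identified with 1-periodic functions on $\mathbb R$; $H^s=H^s(\mathbb S)$ (real-valued); $u_{0,x}=\partial_xu_0$. $\mu(w)=\int_{\mathbb S}w\,dx$ and $A=\mu-\partial_x^2$ (i.e. $Aw=\mu(w)-w_{xx}$), an isomorphism $H^s\to H^{s-2}$. The weakly dissipative $\mu$HS equation is $y_t+uy_x+2u_xy+\lambda y=0$ for $t>0$, $x\in\mathbb R$, with $y=\mu(u)-u_{xx}$, $u(0,x)=u_0(x)$, $u(t,x+1)=u(t,x)$; equivalently $$u_t+uu_x=-\partial_xA^{-1}\left(2\mu_0e^{-\lambda t}u+\tfrac12u_x^2\right)-\lambda u,\qquad u(0,\cdot)=u_0,\quad \mu_0=\mu(u_0).$$ For $u_0\in H^s$, $s>\frac32$, there is a unique solution $u\in C([0,T);H^s)\cap C^1([0,T);H^{s-1})$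 of this nonlocal form (as an equation in $H^{s-1}$), where $T=T(u_0)\in(0,\infty]$ is the maximal existence time. "Blows up in finite time" means $T<\infty$. *)

theory Defs
  imports "HOL-Analysis.Analysis"
begin

text \<open>
  Functions on the circle \<open>\<real>/\<int>\<close> are 1-periodic functions on \<open>\<real>\<close>.
\<close>

definition fourier_coeff :: "(real \<Rightarrow> real) \<Rightarrow> int \<Rightarrow> complex" where
  "fourier_coeff f n = integral {0..1} (\<lambda>x. f x *\<^sub>R cis (- (2 * pi * of_int n * x)))"

text \<open>
  The real-valued Sobolev space \<open>H\<^sup>r\<close> of the circle, for \<open>r > 1/2\<close>. In that range every element
  has exactly one continuous representative, and the space is identified with the set of
  these representatives; equality in \<open>H\<^sup>r\<close> is then equality of functions. Only the exponents
  \<open>s\<close>, \<open>s - 1\<close> and \<open>s + 1\<close> with \<open>s > 3/2\<close> occur below. Elements of \<open>H\<^sup>r\<close> are \<open>C\<^sup>1\<close> for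
  \<open>r > 3/2\<close> and \<open>C\<^sup>2\<close> for \<open>r > 5/2\<close>, so \<open>deriv\<close> is the classical derivative wherever it is used.
\<close>

definition sobolev :: "real \<Rightarrow> (real \<Rightarrow> real) set" where
  "sobolev r = {f. continuous_on UNIV f \<and> (\<forall>x. f (x + 1) = f x) \<and>
     (\<lambda>n. (1 + (of_int n)\<^sup>2) powr r * (norm (fourier_coeff f n))\<^sup>2) summable_on UNIV}"

definition sobolev_norm :: "real \<Rightarrow> (real \<Rightarrow> real) \<Rightarrow> real" where
  "sobolev_norm r f =
     sqrt (\<Sum>\<^sub>\<infinity>n. (1 + (of_int n)\<^sup>2) powr r * (norm (fourier_coeff f n))\<^sup>2)"

definition sobolev_continuous_on :: "real \<Rightarrow> real set \<Rightarrow> (real \<Rightarrow> real \<Rightarrow> real) \<Rightarrow> bool" where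
  "sobolev_continuous_on r J u \<longleftrightarrow>
     (\<forall>t\<in>J. u t \<in> sobolev r) \<and>
     (\<forall>t\<in>J. ((\<lambda>\<tau>. sobolev_norm r (\<lambda>x. u \<tau> x - u t x)) \<longlongrightarrow> 0) (at t within J))"

text \<open>
  \<open>v\<close> is the derivative of the curve \<open>u\<close> in the norm of \<open>H\<^sup>r\<close>, one-sided at an end point
  belonging to \<open>J\<close>.
\<close>

definition sobolev_has_derivative_on ::
    "real \<Rightarrow> real set \<Rightarrow> (real \<Rightarrow> real \<Rightarrow> real) \<Rightarrow> (real \<Rightarrow> real \<Rightarrow> real) \<Rightarrow> bool" where
  "sobolev_has_derivative_on r J u v \<longleftrightarrow>
     (\<forall>t\<in>J. u t \<in> sobolev r \<and> v t \<in> sobolev r) \<and>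
     (\<forall>t\<in>J. ((\<lambda>\<tau>. sobolev_norm r (\<lambda>x. (u \<tau> x - u t x) / (\<tau> - t) - v t x)) \<longlongrightarrow> 0)
        (at t within J))"

definition mean :: "(real \<Rightarrow> real) \<Rightarrow> real" where
  "mean w = integral {0..1} w"

definition A_op :: "(real \<Rightarrow> real) \<Rightarrow> real \<Rightarrow> real" where
  "A_op w = (\<lambda>x. mean w - deriv (deriv w) x)"

text \<open>
  Inverse of the isomorphism \<open>A_op\<close> from \<open>H\<^bsup>r+2\<^esup>\<close> onto \<open>H\<^sup>r\<close>, for \<open>r > 1/2\<close>.
\<close>

definition A_inv :: "real \<Rightarrow> (real \<Rightarrow> real) \<Rightarrow> real \<Rightarrow> real" where
  "A_inv r = inv_into (sobolev (r + 2)) A_op"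

definition time_interval :: "ereal \<Rightarrow> real set" where
  "time_interval T = {t. 0 \<le> t \<and> ereal t < T}"

text \<open>
  \<open>u\<close> lies in \<open>C([0,T);H\<^sup>s) \<inter> C\<^sup>1([0,T);H\<^bsup>s-1\<^esup>)\<close> with time derivative \<open>v\<close>, and satisfies the nonlocal
  form of the weakly dissipative \<open>\<mu>\<close>HS equation. Both sides are continuous in \<open>x\<close>, so the
  pointwise equation is the equation in \<open>H\<^bsup>s-1\<^esup>\<close>.
\<close>

definition muHS_solution ::
    "real \<Rightarrow> real \<Rightarrow> (real \<Rightarrow> real) \<Rightarrow> ereal \<Rightarrow> (real \<Rightarrow> real \<Rightarrow> real) \<Rightarrow> bool" where
  "muHS_solution lam s u0 T u \<longleftrightarrow>
     sobolev_continuous_on s (time_interval T) u \<and>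
     u 0 = u0 \<and>
     (\<exists>v. sobolev_continuous_on (s - 1) (time_interval T) v \<and>
          sobolev_has_derivative_on (s - 1) (time_interval T) u v \<and>
          (\<forall>t\<in>time_interval T. \<forall>x.
             v t x + u t x * deriv (u t) x =
               - deriv (A_inv (s - 1)
                   (\<lambda>y. 2 * mean u0 * exp (- lam * t) * u t y + (deriv (u t) y)\<^sup>2 / 2)) x
               - lam * u t x))"

text \<open>
  Solutions are unique, so they fit together to a solution on the union of their intervals of
  existence and the supremum below is the maximal existence time.
\<close>

definition max_existence_time :: "real \<Rightarrow> real \<Rightarrow> (real \<Rightarrow> real) \<Rightarrow> ereal" where
  "max_existence_time lam s u0 = Sup {T. 0 < T \<and> (\<exists>u. muHS_solution lam s u0 T u)}"

definition blows_up_in_finite_time :: "real \<Rightarrow> real \<Rightarrow> (real \<Rightarrow> real) \<Rightarrow> bool" where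
  "blows_up_in_finite_time lam s u0 \<longleftrightarrow> max_existence_time lam s u0 < \<infinity>"

end

theory Submission
  imports Defs
begin

text \<open>
  Let \<open>E t = \<integral>u\<^sub>x\<^sup>2\<close> and \<open>V t = \<integral>u\<^sub>x\<^sup>3\<close> for a solution \<open>u\<close> on \<open>[0,T)\<close>. Differentiating the
  nonlocal equation in \<open>x\<close> gives, along the flow of \<open>u\<close>, an equation of Riccati type for
  \<open>u\<^sub>x\<close>. Integrated, it shows that the mean of \<open>u\<close> decays like \<open>exp (- lam t)\<close>, that \<open>E t = E
  0 exp (- 2 lam t)\<close>, and that \<open>V' = - 1/2 \<integral>u\<^sub>x\<^sup>4 + 6 mu0 exp (- lam t) \<integral>u u\<^sub>x\<^sup>2 - 3 mean(f) E
  - 3 lam V\<close>, where \<open>f = 2 mu0 exp (- lam t) u + u\<^sub>x\<^sup>2/2\<close> has nonnegative mean. Cauchy-Schwarz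
  bounds \<open>\<integral>u\<^sub>x\<^sup>4\<close> below by \<open>V\<^sup>2 / E\<close>, and the sharp estimate \<open>\<bar>u - mean u\<bar> \<le> (sqrt 3 / 6) sqrt
  E\<close> bounds the term with \<open>u u\<^sub>x\<^sup>2\<close> by \<open>K\<close>. Hence \<open>V' \<le> - V\<^sup>2 / (2 mu1\<^sup>2) - 3 lam V + K\<close>. The
  hypothesis says that \<open>V 0\<close> lies below the smaller root \<open>r\<close> of the right-hand side, so \<open>V\<close>
  would reach \<open>-\<infinity>\<close> before the time \<open>2 mu1\<^sup>2 / (r - V 0)\<close>. This number depends on the initial
  value alone and therefore bounds the interval of existence of every solution, and with it
  the supremum of these intervals, the maximal existence time.

  For \<open>s\<close> close to \<open>3/2\<close> the function \<open>u\<^sub>x\<close> is only continuous in \<open>x\<close>, and its time derivative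
  is a distribution, so the moments of \<open>u\<^sub>x\<close> cannot be differentiated under the integral sign.
  Instead of approximating by smooth solutions, \<open>moment_derivative\<close> replaces \<open>u\<^sub>x\<close> by the
  difference quotient of \<open>u\<close> in \<open>x\<close>. Its powers have \<open>C\<^sup>1\<close> moments, the transport term can be
  integrated by parts exactly, and the resulting formula passes to the limit uniformly in \<open>t\<close>.
  All this uses the equation only through \<open>C\<^sup>1\<close> facts, collected in the locale
  \<open>muHS_classical\<close>.

  The remaining work is to extract these facts from the definitions by Fourier coefficients:
  elements of \<open>H\<^sup>r\<close> with \<open>r > 1/2\<close> have absolutely convergent Fourier series, which gives the
  embedding into the continuous functions (\<open>sobolev_sup_bound\<close>) and, one order higher, into
  the \<open>C\<^sup>1\<close> functions (\<open>sobolev_C1\<close>). The inverse of \<open>\<mu> - \<partial>\<^sub>x\<^sup>2\<close> is meaningful only on the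
  image of \<open>H\<^bsup>r+2\<^esup>\<close>; that the right-hand side \<open>f\<close> lies there requires \<open>u\<^sub>x\<^sup>2 \<in> H\<^bsup>s-1\<^esup>\<close>
  (\<open>sobolev_square\<close>) and elliptic regularity (\<open>A_op_surj\<close>).
\<close>

section \<open>Fourier coefficients of continuous periodic functions\<close>

definition trig :: "int \<Rightarrow> real \<Rightarrow> complex" where
  "trig n x = cis (2 * pi * of_int n * x)"

text \<open>
  Sums of Fourier series and their antiderivatives are complex-valued, so coefficients of such
  functions are needed as well.
\<close>

definition fc :: "(real \<Rightarrow> complex) \<Rightarrow> int \<Rightarrow> complex" where
  "fc f n = integral {0..1} (\<lambda>x. f x * trig (- n) x)"

lemma fourier_coeff_eq_fc: "fourier_coeff f n = fc (\<lambda>x. complex_of_real (f x)) n"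
  by (simp add: fourier_coeff_def fc_def trig_def scaleR_conv_of_real)

lemma trig_0 [simp]: "trig 0 x = 1"
  by (simp add: trig_def)

lemma trig_mult: "trig m x * trig n x = trig (m + n) x"
  by (simp add: trig_def cis_mult algebra_simps)

lemma norm_trig [simp]: "norm (trig n x) = 1"
  by (simp add: trig_def)

lemma cis_add_2pi_int: "cis (a + 2 * pi * of_int n) = cis a"
  by (simp add: cis_mult [symmetric] cis_multiple_2pi)

lemma trig_periodic: "trig n (x + 1) = trig n x"
  using cis_add_2pi_int[of "2 * pi * of_int n * x" n] by (simp add: trig_def algebra_simps)

lemma trig_at_1: "trig n 1 = 1"
  using trig_periodic[of n 0] by (simp add: trig_def)

lemma trig_at_0: "trig n 0 = 1"
  by (simp add: trig_def)

lemma continuous_on_trig [continuous_intros]: "continuous_on S (trig n)"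
  unfolding trig_def by (intro continuous_intros)

lemma has_vector_derivative_trig:
  "(trig n has_vector_derivative (2 * pi * of_int n * \<i>) * trig n x) (at x within S)"
proof -
  have "((\<lambda>z. exp (\<i> * (2 * of_real pi * of_int n * z))) has_field_derivative
      (2 * pi * of_int n * \<i>) * trig n x) (at (of_real x))"
    by (auto intro!: derivative_eq_intros simp: trig_def cis_conv_exp)
  from has_vector_derivative_real_field[OF this] show ?thesis
    by (simp add: trig_def [abs_def] cis_conv_exp)
qed

lemma integral_trig: "integral {0..1} (trig n) = (if n = 0 then 1 else 0)"
proof (cases "n = 0")
  case False
  have "((\<lambda>x. (2 * pi * of_int n * \<i>) * trig n x) has_integral trig n 1 - trig n 0) {0..1}"
    by (intro fundamental_theorem_of_calculus has_vector_derivative_trig) auto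
  then have "((\<lambda>x. (2 * pi * of_int n * \<i>) * trig n x) has_integral 0) {0..1}"
    by (simp add: trig_at_1) (simp add: trig_def)
  then have "(trig n has_integral 0) {0..1}"
    using has_integral_mult_right[of "\<lambda>x. (2 * pi * of_int n * \<i>) * trig n x" 0 "{0..1}" "inverse (2 * pi * of_int n * \<i>)"] False
    by (simp add: field_simps)
  with False show ?thesis by (simp add: integral_unique)
next
  case True
  then have "trig n = (\<lambda>x. 1)" by (auto simp: fun_eq_iff)
  with True show ?thesis by simp
qed

lemma periodic_add_int:
  fixes f :: "real \<Rightarrow> 'a"
  assumes "\<And>x. f (x + 1) = f x"
  shows "f (x + of_int n) = f x"
proof (induction n rule: int_induct[where k = 0])
  case (step1 i)
  then show ?case using assms[of "x + of_int i"] by (simp add: algebra_simps)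
next
  case (step2 i)
  then show ?case using assms[of "x + of_int (i - 1)"] by (simp add: algebra_simps)
qed simp

lemma periodic_frac:
  fixes f :: "real \<Rightarrow> 'a"
  assumes "\<And>x. f (x + 1) = f x"
  shows "f x = f (frac x)"
  using periodic_add_int[of f, OF assms, of "frac x" "\<lfloor>x\<rfloor>"] by (simp add: frac_def)

lemma frac_in_unit: "frac x \<in> {0..(1::real)}"
  by (simp add: frac_ge_0 less_imp_le frac_lt_1)

text \<open>
  The Stone-Weierstrass theorem needs a compact domain on which polynomials separate points;
  the unit interval with identified end points is replaced by the unit circle. Continuity of
  the factor is checked on closed sets, whose preimages are compact images of closed subsets
  of the interval.
\<close>

lemma periodic_factors_through_circle:
  fixes a :: "real \<Rightarrow> real"
  assumes cont: "continuous_on UNIV a" and per: "\<And>x. a (x + 1) = a x"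
  obtains \<phi> :: "complex \<Rightarrow> real" where "continuous_on (sphere 0 1) \<phi>" "\<And>x. \<phi> (trig 1 x) = a x"
proof -
  define \<phi> where "\<phi> z = a (SOME x. trig 1 x = z)" for z
  have eq: "\<phi> (trig 1 x) = a x" for x
  proof -
    define y where "y = (SOME y. trig 1 y = trig 1 x)"
    have "trig 1 y = trig 1 x"
      unfolding y_def by (rule someI[of _ x]) simp
    then have "sin (2 * pi * y) = sin (2 * pi * x) \<and> cos (2 * pi * y) = cos (2 * pi * x)"
      by (simp add: trig_def complex_eq_iff)
    then obtain n :: int where "2 * pi * y = 2 * pi * x + 2 * pi * of_int n"
      using sin_cos_eq_iff by blast
    then have "2 * pi * y = 2 * pi * (x + of_int n)" by (simp add: algebra_simps)
    then have "y = x + of_int n" by simp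
    then have "a y = a x" using periodic_add_int[of a, OF per] by simp
    then show ?thesis by (simp add: \<phi>_def y_def)
  qed
  have surj: "\<exists>x\<in>{0..1}. trig 1 x = z" if "z \<in> sphere 0 1" for z
  proof -
    from that have "norm z = 1" by simp
    then have "z = cis (Arg z)" by (metis cis_Arg norm_zero sgn_eq div_by_1 of_real_1 zero_neq_one scaleR_one inverse_1 sgn_div_norm)
    then have "z = trig 1 (Arg z / (2 * pi))" by (simp add: trig_def)
    then have "z = trig 1 (frac (Arg z / (2 * pi)))"
      using periodic_frac[of "trig 1", OF trig_periodic] by metis
    then show ?thesis using frac_in_unit by metis
  qed
  have "continuous_on (sphere 0 1) \<phi>"
    unfolding continuous_on_closed_invariant
  proof (intro allI impI)
    fix B :: "real set" assume B: "closed B"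
    have "closed ({0..1} \<inter> a -` B)"
      using B cont by (intro continuous_closed_preimage) (auto intro: continuous_on_subset)
    then have "compact ({0..1} \<inter> a -` B)"
      by (metis bounded_Int bounded_closed_interval compact_eq_bounded_closed)
    then have "compact (trig 1 ` ({0..1} \<inter> a -` B))"
      by (intro compact_continuous_image continuous_on_trig)
    then have "closed (trig 1 ` ({0..1} \<inter> a -` B))" by (rule compact_imp_closed)
    moreover have "trig 1 ` ({0..1} \<inter> a -` B) \<inter> sphere 0 1 = \<phi> -` B \<inter> sphere 0 1"
    proof (intro equalityI subsetI)
      fix z assume "z \<in> \<phi> -` B \<inter> sphere 0 1"
      then show "z \<in> trig 1 ` ({0..1} \<inter> a -` B) \<inter> sphere 0 1"
        using surj[of z] eq by (metis IntD1 IntD2 IntI image_eqI vimageD vimageI)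
    qed (use eq in auto)
    ultimately show "\<exists>A. closed A \<and> A \<inter> sphere 0 1 = \<phi> -` B \<inter> sphere 0 1" by blast
  qed
  with eq show ?thesis using that by blast
qed

lemma trig_1_in_sphere: "trig 1 x \<in> sphere 0 1"
  by simp

text \<open>
  The property of having only vanishing Fourier coefficients survives multiplication by \<open>Re\<close>
  and \<open>Im\<close> of \<open>exp (2 \<pi> i x)\<close>, since these only shift the coefficients. Because the statement
  is quantified over all \<open>h\<close>, a product of two polynomials is treated by applying it twice.
\<close>

lemma vanishing_fc_times_polynomial:
  assumes "real_polynomial_function p"
    and "continuous_on {0..1} h" and "\<And>n. fc h n = 0"
  shows "fc (\<lambda>x. h x * of_real (p (trig 1 x))) n = 0"
  using assms
proof (induction p arbitrary: h n rule: real_polynomial_function.induct)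
  case (linear L)
  \<comment> \<open>A real linear form on the circle is a combination of \<open>z\<close> and its conjugate, that is of the
    characters of frequencies \<open>1\<close> and \<open>- 1\<close>.\<close>
  define \<alpha> \<beta> where "\<alpha> = (L 1 - \<i> * L \<i>) / 2" and "\<beta> = (L 1 + \<i> * L \<i>) / 2"
  have L: "of_real (L (trig 1 x)) = \<alpha> * trig 1 x + \<beta> * trig (-1) x" for x
  proof -
    have "trig 1 x = cos (2*pi*x) *\<^sub>R 1 + sin (2*pi*x) *\<^sub>R \<i>"
      by (simp add: trig_def complex_eq_iff)
    then have "L (trig 1 x) = cos (2*pi*x) * L 1 + sin (2*pi*x) * L \<i>"
      using linear(1) by (simp add: bounded_linear_def linear_add linear_scale)
    then show ?thesis
      by (simp add: \<alpha>_def \<beta>_def trig_def complex_eq_iff field_simps)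
  qed
  have int: "(\<lambda>x. h x * trig m x) integrable_on {0..1}" for m
    by (intro integrable_continuous_real continuous_intros linear)
  have "fc (\<lambda>x. h x * of_real (L (trig 1 x))) n =
      integral {0..1} (\<lambda>x. \<alpha> * (h x * trig (- (n - 1)) x) + \<beta> * (h x * trig (- (n + 1)) x))"
    unfolding fc_def L
    by (rule arg_cong[where f = "integral {0..1}"])
       (auto simp: fun_eq_iff algebra_simps trig_mult mult.left_commute[of _ "trig _ _"])
  also have "\<dots> = \<alpha> * fc h (n - 1) + \<beta> * fc h (n + 1)"
    unfolding fc_def using int[of "-(n - 1)"] int[of "-(n+1)"]
    by (subst integral_add) (auto intro: integrable_on_mult_right)
  finally show ?case using linear by simp
next
  case (const c)
  have "fc (\<lambda>x. h x * of_real c) n = integral {0..1} (\<lambda>x. of_real c * (h x * trig (- n) x))"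
    by (simp add: fc_def algebra_simps)
  also have "\<dots> = of_real c * fc h n" unfolding fc_def by simp
  finally show ?case using const by simp
next
  case (add f g)
  have cont: "continuous_on {0..1} (\<lambda>x. h x * of_real (q (trig 1 x)))"
    if "real_polynomial_function q" for q
    using that add.prems
    by (intro continuous_intros continuous_on_compose2[OF _ continuous_on_trig, of UNIV q])
       (auto simp: real_polynomial_function_eq continuous_on_polymonial_function)
  have "fc (\<lambda>x. h x * of_real (f (trig 1 x) + g (trig 1 x))) n =
     integral {0..1} (\<lambda>x. (h x * of_real (f (trig 1 x))) * trig (-n) x
                       + (h x * of_real (g (trig 1 x))) * trig (-n) x)"
    by (simp add: fc_def algebra_simps)
  also have "\<dots> = fc (\<lambda>x. h x * of_real (f (trig 1 x))) n + fc (\<lambda>x. h x * of_real (g (trig 1 x))) n"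
    unfolding fc_def
    by (intro integral_add integrable_continuous_real continuous_intros cont add)
  finally show ?case using add by simp
next
  case (mult f g)
  have cont: "continuous_on {0..1} (\<lambda>x. h x * of_real (f (trig 1 x)))"
    using mult
    by (intro continuous_intros continuous_on_compose2[OF _ continuous_on_trig, of UNIV f])
       (auto simp: real_polynomial_function_eq continuous_on_polymonial_function)
  have "fc (\<lambda>x. (h x * of_real (f (trig 1 x))) * of_real (g (trig 1 x))) n = 0"
    using mult.IH(2)[OF cont] mult.IH(1)[OF mult.prems] by simp
  then show ?case by (simp add: mult.assoc)
qed

lemma vanishing_fc_orthogonal:
  fixes a :: "real \<Rightarrow> real"
  assumes g: "continuous_on {0..1} g" "\<And>n. fc g n = 0"
    and a: "continuous_on UNIV a" "\<And>x. a (x + 1) = a x"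
  shows "integral {0..1} (\<lambda>x. g x * of_real (a x)) = 0"
proof -
  obtain \<phi> where \<phi>: "continuous_on (sphere 0 1) \<phi>" "\<And>x. \<phi> (trig 1 x) = a x"
    using periodic_factors_through_circle a by blast
  define M where "M = integral {0..1} (\<lambda>x. norm (g x))"
  have M0: "M \<ge> 0" unfolding M_def
    by (intro integral_nonneg integrable_continuous_real continuous_intros g) auto
  have "norm (integral {0..1} (\<lambda>x. g x * of_real (a x))) \<le> e" if "e > 0" for e
  proof -
    have "e / (M + 1) > 0" using that M0 by simp
    then obtain p where p: "real_polynomial_function p" "\<And>z. z \<in> sphere 0 1 \<Longrightarrow> \<bar>\<phi> z - p z\<bar> < e / (M + 1)"
      using Stone_Weierstrass_real_polynomial_function[OF compact_sphere \<phi>(1)] by metis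
    have pc: "continuous_on {0..1} (\<lambda>x. p (trig 1 x))"
      using p(1) by (intro continuous_on_compose2[OF _ continuous_on_trig, of UNIV p])
       (auto simp: real_polynomial_function_eq continuous_on_polymonial_function)
    have ac: "continuous_on {0..1} a" using a continuous_on_subset by blast
    have "integral {0..1} (\<lambda>x. g x * of_real (p (trig 1 x))) = 0"
      using vanishing_fc_times_polynomial[OF p(1) g, of 0] by (simp add: fc_def)
    then have "integral {0..1} (\<lambda>x. g x * of_real (a x)) =
        integral {0..1} (\<lambda>x. g x * of_real (a x) - g x * of_real (p (trig 1 x)))"
      by (subst integral_diff) (auto intro!: integrable_continuous_real continuous_intros g ac pc)
    also have "norm \<dots> \<le> integral {0..1} (\<lambda>x. e / (M + 1) * norm (g x))"
    proof (rule integral_norm_bound_integral)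
      fix x :: real
      have "norm (g x * of_real (a x) - g x * of_real (p (trig 1 x))) = norm (g x) * \<bar>a x - p (trig 1 x)\<bar>"
        by (metis norm_mult norm_of_real of_real_diff right_diff_distrib)
      also have "\<dots> \<le> norm (g x) * (e / (M + 1))"
        using p(2)[OF trig_1_in_sphere, of x] \<phi>(2)[of x] by (intro mult_left_mono) auto
      finally show "norm (g x * of_real (a x) - g x * of_real (p (trig 1 x))) \<le> e / (M + 1) * norm (g x)"
        by (simp add: mult.commute)
    qed (use M0 in \<open>auto intro!: integrable_continuous_real continuous_intros g ac pc\<close>)
    also have "\<dots> = e / (M + 1) * M" unfolding M_def by simp
    also have "\<dots> \<le> e" using that M0 by (simp add: field_simps)
    finally show ?thesis .
  qed
  then have "norm (integral {0..1} (\<lambda>x. g x * of_real (a x))) \<le> 0"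
    by (rule dense_ge)
  then show ?thesis by simp
qed

lemma integral_continuous_nonneg_eq_0:
  fixes f :: "real \<Rightarrow> real"
  assumes "continuous_on {0..1} f" "\<And>x. f x \<ge> 0" "integral {0..1} f = 0" "x \<in> {0..1}"
  shows "f x = 0"
proof -
  have "(f has_integral 0) (cbox 0 1)"
    using assms by (metis box_real(2) has_integral_integral integrable_continuous_real)
  then show ?thesis
    using has_integral_0_cbox_imp_0[of 0 1 f x] assms by auto
qed

text \<open>
  By approximation, \<open>g\<close> is orthogonal to every real continuous periodic function, in
  particular to its own real and imaginary parts.
\<close>

theorem fc_unique:
  assumes g: "continuous_on UNIV g" "\<And>x. g (x + 1) = g x" "\<And>n. fc g n = 0"
  shows "g x = 0"
proof -
  have gc: "continuous_on {0..1} g" using g continuous_on_subset by blast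
  \<comment> \<open>\<open>L\<close> stands for \<open>Re\<close> and for \<open>Im\<close>.\<close>
  have part: "L (g y) = 0" if L: "bounded_linear L" "\<And>z r. L (z * of_real r) = L z * r" and y: "y \<in> {0..1}"
    for L :: "complex \<Rightarrow> real" and y
  proof -
    have Lc: "continuous_on S (\<lambda>x. L (g x))" for S
      using g(1) by (intro bounded_linear.continuous_on[OF L(1)]) (auto intro: continuous_on_subset)
    have "integral {0..1} (L \<circ> (\<lambda>x. g x * of_real (L (g x)))) =
        L (integral {0..1} (\<lambda>x. g x * of_real (L (g x))))"
      by (intro integral_linear L integrable_continuous_real continuous_intros gc Lc)
    also have "integral {0..1} (\<lambda>x. g x * of_real (L (g x))) = 0"
      by (rule vanishing_fc_orthogonal[OF gc g(3)]) (auto intro!: Lc simp: g(2))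
    finally have "integral {0..1} (\<lambda>x. L (g x) * L (g x)) = 0"
      using L by (simp add: o_def linear_0 bounded_linear.linear)
    then show ?thesis
      using integral_continuous_nonneg_eq_0[OF continuous_on_mult[OF Lc Lc], of y] y by auto
  qed
  have "Re (g y) = 0 \<and> Im (g y) = 0" if "y \<in> {0..1}" for y
    using part[OF bounded_linear_Re _ that] part[OF bounded_linear_Im _ that] by simp
  then have "g (frac x) = 0" using frac_in_unit[of x] by (simp add: complex_eq_iff)
  then show ?thesis using periodic_frac[of g, OF g(2)] by metis
qed

definition trig_series :: "(int \<Rightarrow> complex) \<Rightarrow> real \<Rightarrow> complex" where
  "trig_series c x = (\<Sum>\<^sub>\<infinity>n. c n * trig n x)"

context
  fixes c :: "int \<Rightarrow> complex"
  assumes c: "(\<lambda>n. norm (c n)) summable_on UNIV"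
begin

lemma trig_series_uniform_limit:
  "uniform_limit Y (\<lambda>F x. \<Sum>n\<in>F. c n * trig n x) (trig_series c) (finite_subsets_at_top UNIV)"
  unfolding trig_series_def
  by (rule Weierstrass_m_test_general[OF _ c]) (simp add: norm_mult)

lemma continuous_on_trig_series: "continuous_on UNIV (trig_series c)"
  by (rule uniform_limit_theorem[OF _ trig_series_uniform_limit])
     (auto intro!: always_eventually continuous_intros)

lemma trig_series_periodic: "trig_series c (x + 1) = trig_series c x"
  by (simp add: trig_series_def trig_periodic)

lemma norm_trig_series_le: "norm (trig_series c x) \<le> (\<Sum>\<^sub>\<infinity>n. norm (c n))"
  unfolding trig_series_def using c
  by (intro order.trans[OF norm_infsum_bound]) (auto simp: norm_mult)

text \<open>
  Uniform convergence of an absolutely summable trigonometric series allows termwise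
  integration. With a character for \<open>h\<close> this gives the coefficients of the sum; with a
  character times another function it gives the convolution formula for products.
\<close>

lemma has_sum_integral_trig_series:
  assumes h: "continuous_on {0..1} h"
  shows "((\<lambda>n. c n * integral {0..1} (\<lambda>x. trig n x * h x))
            has_sum integral {0..1} (\<lambda>x. trig_series c x * h x)) UNIV"
proof -
  have lim: "uniform_limit {0..1} (\<lambda>F x. (\<Sum>n\<in>F. c n * trig n x) * h x)
     (\<lambda>x. trig_series c x * h x) (finite_subsets_at_top UNIV)"
  proof (rule uniform_lim_mult[OF trig_series_uniform_limit uniform_limit_const])
    show "bounded (trig_series c ` {0..1})"
      using norm_trig_series_le by (auto simp: bounded_iff)
    show "bounded (h ` {0..1})"
      using h compact_continuous_image compact_imp_bounded by blast
  qed
  obtain I J where I: "\<And>F. ((\<lambda>x. (\<Sum>n\<in>F. c n * trig n x) * h x) has_integral I F) {0..1}"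
    and J: "((\<lambda>x. trig_series c x * h x) has_integral J) {0..1}"
    and IJ: "(I \<longlongrightarrow> J) (finite_subsets_at_top UNIV)"
    by (rule uniform_limit_integral[OF lim]) (auto intro!: continuous_intros h)
  have "I F = (\<Sum>n\<in>F. c n * integral {0..1} (\<lambda>x. trig n x * h x))" if "finite F" for F
  proof -
    have "I F = integral {0..1} (\<lambda>x. \<Sum>n\<in>F. c n * (trig n x * h x))"
      using integral_unique[OF I[of F]] by (simp add: sum_distrib_right mult.assoc)
    also have "\<dots> = (\<Sum>n\<in>F. integral {0..1} (\<lambda>x. c n * (trig n x * h x)))"
      by (intro integral_sum that integrable_continuous_real continuous_intros h)
    finally show ?thesis by simp
  qed
  then have "(\<forall>\<^sub>F F in finite_subsets_at_top UNIV. I F = (\<Sum>n\<in>F. c n * integral {0..1} (\<lambda>x. trig n x * h x)))"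
    by (auto intro: eventually_finite_subsets_at_top_weakI)
  with IJ show ?thesis
    unfolding has_sum_def integral_unique[OF J] using tendsto_cong by force
qed

lemma fc_trig_series: "fc (trig_series c) m = c m"
proof -
  have "((\<lambda>n. c n * integral {0..1} (\<lambda>x. trig n x * trig (-m) x))
            has_sum fc (trig_series c) m) UNIV"
    unfolding fc_def by (rule has_sum_integral_trig_series) (intro continuous_intros)
  moreover have "integral {0..1} (\<lambda>x. trig n x * trig (-m) x) = (if n = m then 1 else 0)" for n
    using integral_trig[of "n - m"] by (simp add: trig_mult)
  ultimately have "((\<lambda>n. if n = m then c m else 0) has_sum fc (trig_series c) m) UNIV"
    by (simp add: if_distrib cong: if_cong)
  moreover have "((\<lambda>n. if n = m then c m else 0) has_sum c m) UNIV"
    by (rule has_sum_finite_neutralI[of "{m}"]) auto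
  ultimately show ?thesis using has_sum_unique by blast
qed

end

lemma fc_diff:
  assumes "continuous_on {0..1} f" "continuous_on {0..1} g"
  shows "fc (\<lambda>x. f x - g x) n = fc f n - fc g n"
  unfolding fc_def left_diff_distrib
  by (intro integral_diff integrable_continuous_real continuous_intros assms)

text \<open>
  The series has the same Fourier coefficients as \<open>f\<close>, so uniqueness applies.
\<close>

theorem fourier_inversion:
  assumes f: "continuous_on UNIV f" "\<And>x. f (x + 1) = f x"
    and s: "(\<lambda>n. norm (fc f n)) summable_on UNIV"
  shows "trig_series (fc f) = f"
proof
  fix x
  have c: "continuous_on {0..1} f" "continuous_on {0..1} (trig_series (fc f))"
    using f continuous_on_trig_series[OF s] continuous_on_subset by blast+
  have "trig_series (fc f) x - f x = 0"
    by (rule fc_unique)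
       (auto intro!: continuous_intros f continuous_on_trig_series[OF s]
          simp: fc_diff c fc_trig_series[OF s] f(2) trig_series_periodic[OF s])
  then show "trig_series (fc f) x = f x" by simp
qed

lemma fc_mult_has_sum:
  assumes f: "continuous_on UNIV f" "\<And>x. f (x + 1) = f x"
    and s: "(\<lambda>n. norm (fc f n)) summable_on UNIV"
    and g: "continuous_on {0..1} g"
  shows "((\<lambda>k. fc f k * fc g (n - k)) has_sum fc (\<lambda>x. f x * g x) n) UNIV"
proof -
  have "((\<lambda>k. fc f k * integral {0..1} (\<lambda>x. trig k x * (g x * trig (-n) x)))
            has_sum integral {0..1} (\<lambda>x. trig_series (fc f) x * (g x * trig (-n) x))) UNIV"
    by (rule has_sum_integral_trig_series[OF s]) (intro continuous_intros g)
  moreover have "trig k x * (g x * trig (-n) x) = g x * trig (-(n - k)) x" for k x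
    using trig_mult[of k x "-n"] by (simp add: algebra_simps)
  ultimately show ?thesis
    by (simp add: fourier_inversion[OF f s] fc_def mult.assoc)
qed

lemma fc_derivative:
  assumes F: "\<And>x. (F has_vector_derivative F' x) (at x)"
    and F': "continuous_on UNIV F'" and per: "F 1 = F 0"
  shows "fc F' n = (2 * pi * of_int n * \<i>) * fc F n"
proof -
  have Fc: "continuous_on {0..1} F"
    using F by (meson continuous_at_imp_continuous_on has_vector_derivative_continuous)
  have F'c: "continuous_on {0..1} F'" using F' continuous_on_subset by blast
  have "((\<lambda>x. F x * ((2 * pi * of_int (-n) * \<i>) * trig (-n) x) + F' x * trig (-n) x)
      has_integral F 1 * trig (-n) 1 - F 0 * trig (-n) 0) {0..1}"
    by (intro fundamental_theorem_of_calculus has_vector_derivative_mult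
         has_vector_derivative_trig) (auto intro: F has_vector_derivative_at_within)
  then have "integral {0..1} (\<lambda>x. (2 * pi * of_int (-n) * \<i>) * (F x * trig (-n) x) + F' x * trig (-n) x) = 0"
    by (intro integral_unique) (simp add: per trig_at_1 trig_at_0 algebra_simps)
  moreover have "integral {0..1} (\<lambda>x. (2 * pi * of_int (-n) * \<i>) * (F x * trig (-n) x) + F' x * trig (-n) x)
     = (2 * pi * of_int (-n) * \<i>) * fc F n + fc F' n"
    unfolding fc_def
    by (subst integral_add) (auto intro!: integrable_continuous_real continuous_intros Fc F'c)
  ultimately show ?thesis by (simp add: add_eq_0_iff2)
qed

section \<open>Sobolev spaces of the circle\<close>

definition weight :: "real \<Rightarrow> int \<Rightarrow> real" where
  "weight r n = (1 + (real_of_int n)\<^sup>2) powr r"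

lemma weight_pos [simp]: "weight r n > 0"
proof -
  have "1 + (real_of_int n)\<^sup>2 > 0" by (simp add: add_pos_nonneg)
  then show ?thesis by (simp add: weight_def)
qed

lemma weight_nonneg [simp]: "weight r n \<ge> 0"
  using weight_pos less_imp_le by blast

lemma weight_add: "weight (r + q) n = weight r n * weight q n"
  by (simp add: weight_def powr_add)

lemma weight_0 [simp]: "weight 0 n = 1"
proof -
  have "1 + (real_of_int n)\<^sup>2 > 0" by (simp add: add_pos_nonneg)
  then show ?thesis unfolding weight_def by (metis less_irrefl powr_zero_eq_one)
qed

lemma weight_half: "(weight (r / 2) n)\<^sup>2 = weight r n"
  using weight_add[of "r/2" "r/2" n] by (simp add: power2_eq_square)

lemma weight_1: "weight 1 n = 1 + (real_of_int n)\<^sup>2"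
  by (simp add: weight_def add_nonneg_nonneg)

lemma mem_sobolev_iff:
  "f \<in> sobolev r \<longleftrightarrow> continuous_on UNIV f \<and> (\<forall>x. f (x + 1) = f x) \<and>
     (\<lambda>n. weight r n * (norm (fourier_coeff f n))\<^sup>2) summable_on UNIV"
  by (simp add: sobolev_def weight_def)

lemma sobolev_norm_eq:
  "sobolev_norm r f = sqrt (\<Sum>\<^sub>\<infinity>n. weight r n * (norm (fourier_coeff f n))\<^sup>2)"
  by (simp add: sobolev_norm_def weight_def)

lemma sobolevD:
  assumes "f \<in> sobolev r"
  shows "continuous_on S f" "f (x + 1) = f x"
    "(\<lambda>n. weight r n * (norm (fourier_coeff f n))\<^sup>2) summable_on UNIV"
  using assms by (auto simp: mem_sobolev_iff intro: continuous_on_subset)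

text \<open>
  The threshold \<open>1/2\<close> of the Sobolev embedding comes from here: the weights behave like \<open>\<bar>n\<bar>\<close>
  to the power \<open>- 2 r\<close>.
\<close>

lemma summable_weight:
  assumes "r > 1/2"
  shows "weight (- r) summable_on UNIV"
proof -
  have "summable (\<lambda>n. real n powr (- 2 * r))"
    using assms by (simp add: summable_real_powr_iff)
  moreover have "norm (weight (- r) (int n)) \<le> real n powr (- 2 * r)" if "n \<ge> 1" for n
  proof -
    have "(1 + (real n)\<^sup>2) powr (- r) \<le> ((real n)\<^sup>2) powr (- r)"
      using assms that by (intro powr_mono2') auto
    also have "(real n)\<^sup>2 = real n powr 2" using that by simp
    also have "\<dots> powr (- r) = real n powr (- 2 * r)" by (simp only: powr_powr) simp
    finally show ?thesis by (simp add: weight_def)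
  qed
  ultimately have "summable (\<lambda>n. weight (- r) (int n))"
    by (rule summable_comparison_test'[where N = 1])
  then have nat: "(\<lambda>n. weight (- r) (int n)) summable_on UNIV"
    by (intro summable_nonneg_imp_summable_on) auto
  have 1: "weight (- r) summable_on (range int)"
    using nat by (subst summable_on_reindex) (auto simp: o_def)
  have 2: "weight (- r) summable_on (range (\<lambda>n. - int n))"
    using nat by (subst summable_on_reindex) (auto simp: o_def inj_on_def weight_def)
  have "range int \<union> range (\<lambda>n. - int n) = UNIV"
    by (auto intro: int_cases2)
  with summable_on_union[OF 1 2] show ?thesis by simp
qed

lemma infsum_Cauchy_Schwarz:
  fixes a b :: "'i \<Rightarrow> real"
  assumes a: "(\<lambda>i. (a i)\<^sup>2) summable_on A" and b: "(\<lambda>i. (b i)\<^sup>2) summable_on A"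
  shows "(\<lambda>i. \<bar>a i * b i\<bar>) summable_on A"
    and "(\<Sum>\<^sub>\<infinity>i\<in>A. \<bar>a i * b i\<bar>) \<le> sqrt (\<Sum>\<^sub>\<infinity>i\<in>A. (a i)\<^sup>2) * sqrt (\<Sum>\<^sub>\<infinity>i\<in>A. (b i)\<^sup>2)"
proof -
  let ?B = "sqrt (\<Sum>\<^sub>\<infinity>i\<in>A. (a i)\<^sup>2) * sqrt (\<Sum>\<^sub>\<infinity>i\<in>A. (b i)\<^sup>2)"
  have fin: "(\<Sum>i\<in>F. \<bar>a i * b i\<bar>) \<le> ?B" if F: "finite F" "F \<subseteq> A" for F
  proof -
    have "(\<Sum>i\<in>F. \<bar>a i * b i\<bar>) \<le> L2_set a F * L2_set b F"
      using L2_set_mult_ineq[of a b F] by (simp add: abs_mult)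
    also have "\<dots> \<le> ?B"
      unfolding L2_set_def
      by (intro mult_mono real_sqrt_le_mono finite_sum_le_infsum a b F)
         (auto intro!: real_sqrt_ge_zero sum_nonneg infsum_nonneg)
    finally show ?thesis .
  qed
  show s: "(\<lambda>i. \<bar>a i * b i\<bar>) summable_on A"
    by (rule nonneg_bdd_above_summable_on) (auto intro!: bdd_aboveI[of _ ?B] fin)
  show "(\<Sum>\<^sub>\<infinity>i\<in>A. \<bar>a i * b i\<bar>) \<le> ?B"
    by (rule infsum_le_finite_sums[OF s fin])
qed

text \<open>
  The norm of the embedding of \<open>H\<^sup>r\<close> into the absolutely convergent Fourier series; for \<open>r \<le>
  1/2\<close> the sum diverges and the value is \<open>0\<close>.
\<close>

definition embed_const :: "real \<Rightarrow> real" where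
  "embed_const r = sqrt (\<Sum>\<^sub>\<infinity>n. weight (- r) n)"

lemma embed_const_nonneg: "embed_const r \<ge> 0"
  by (simp add: embed_const_def infsum_nonneg)

lemma weighted_l2_imp_l1:
  fixes c :: "int \<Rightarrow> complex"
  assumes r: "r > 1/2" and c: "(\<lambda>n. weight r n * (norm (c n))\<^sup>2) summable_on UNIV"
  shows "(\<lambda>n. norm (c n)) summable_on UNIV"
    and "(\<Sum>\<^sub>\<infinity>n. norm (c n)) \<le> embed_const r * sqrt (\<Sum>\<^sub>\<infinity>n. weight r n * (norm (c n))\<^sup>2)"
proof -
  define a b where "a = (\<lambda>n. weight (- r / 2) n)" and "b = (\<lambda>n. weight (r / 2) n * norm (c n))"
  have a2: "(a n)\<^sup>2 = weight (- r) n" for n unfolding a_def by (rule weight_half)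
  have b2: "(b n)\<^sup>2 = weight r n * (norm (c n))\<^sup>2" for n unfolding b_def power_mult_distrib weight_half ..
  have ab: "\<bar>a n * b n\<bar> = norm (c n)" for n
    using weight_add[of "- r / 2" "r / 2" n] by (simp add: a_def b_def abs_mult flip: mult.assoc)
  have A: "(\<lambda>n. (a n)\<^sup>2) summable_on UNIV" unfolding a2 using summable_weight[OF r] by simp
  have B: "(\<lambda>n. (b n)\<^sup>2) summable_on UNIV" unfolding b2 using c .
  show "(\<lambda>n. norm (c n)) summable_on UNIV"
    "(\<Sum>\<^sub>\<infinity>n. norm (c n)) \<le> embed_const r * sqrt (\<Sum>\<^sub>\<infinity>n. weight r n * (norm (c n))\<^sup>2)"
    using infsum_Cauchy_Schwarz[OF A B] unfolding ab a2 b2 embed_const_def by auto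
qed

lemma sobolev_fourier_series:
  assumes "f \<in> sobolev r" "r > 1/2"
  shows "(\<lambda>n. norm (fourier_coeff f n)) summable_on UNIV"
    and "trig_series (fourier_coeff f) x = of_real (f x)"
proof -
  show s: "(\<lambda>n. norm (fourier_coeff f n)) summable_on UNIV"
    using weighted_l2_imp_l1(1) assms sobolevD(3) by blast
  have "trig_series (fc (\<lambda>x. complex_of_real (f x))) = (\<lambda>x. complex_of_real (f x))"
    using s by (intro fourier_inversion continuous_intros sobolevD[OF assms(1)])
      (auto simp: fourier_coeff_eq_fc sobolevD[OF assms(1)])
  then show "trig_series (fourier_coeff f) x = of_real (f x)"
    by (simp add: fun_eq_iff fourier_coeff_eq_fc [abs_def])
qed

lemma sobolev_sup_bound:
  assumes "f \<in> sobolev r" "r > 1/2"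
  shows "\<bar>f x\<bar> \<le> embed_const r * sobolev_norm r f"
proof -
  have "\<bar>f x\<bar> = norm (trig_series (fourier_coeff f) x)"
    using sobolev_fourier_series(2)[OF assms] by simp
  also have "\<dots> \<le> (\<Sum>\<^sub>\<infinity>n. norm (fourier_coeff f n))"
    using norm_trig_series_le sobolev_fourier_series(1)[OF assms] .
  also have "\<dots> \<le> embed_const r * sobolev_norm r f"
    unfolding sobolev_norm_eq using weighted_l2_imp_l1(2) assms sobolevD(3) by blast
  finally show ?thesis .
qed

lemma fourier_coeff_lincomb:
  assumes "continuous_on {0..1} f" "continuous_on {0..1} g"
  shows "fourier_coeff (\<lambda>x. a * f x + b * g x) n = of_real a * fourier_coeff f n + of_real b * fourier_coeff g n"
proof -
  have "fourier_coeff (\<lambda>x. a * f x + b * g x) n =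
     integral {0..1} (\<lambda>x. of_real a * (of_real (f x) * trig (-n) x) + of_real b * (of_real (g x) * trig (-n) x))"
    by (simp add: fourier_coeff_eq_fc fc_def algebra_simps)
  also have "\<dots> = of_real a * fourier_coeff f n + of_real b * fourier_coeff g n"
    unfolding fourier_coeff_eq_fc fc_def
    by (subst integral_add) (auto intro!: integrable_continuous_real continuous_intros assms)
  finally show ?thesis .
qed

lemma power2_sum_le: "(x + y)\<^sup>2 \<le> 2 * x\<^sup>2 + 2 * (y\<^sup>2 :: real)"
proof -
  have "(x + y)\<^sup>2 + (x - y)\<^sup>2 = 2 * x\<^sup>2 + 2 * y\<^sup>2" by algebra
  then show ?thesis using zero_le_power2[of "x - y"] by linarith
qed

lemma sobolev_lincomb:
  assumes f: "f \<in> sobolev r" and g: "g \<in> sobolev r"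
  shows "(\<lambda>x. a * f x + b * g x) \<in> sobolev r"
  unfolding mem_sobolev_iff
proof (intro conjI allI)
  show "continuous_on UNIV (\<lambda>x. a * f x + b * g x)"
    by (intro continuous_intros sobolevD[OF f] sobolevD[OF g])
  show "a * f (x + 1) + b * g (x + 1) = a * f x + b * g x" for x
    by (simp add: sobolevD[OF f] sobolevD[OF g])
  let ?p = "\<lambda>n. weight r n * (norm (fourier_coeff f n))\<^sup>2" and ?q = "\<lambda>n. weight r n * (norm (fourier_coeff g n))\<^sup>2"
  have "(\<lambda>n. 2 * a\<^sup>2 * ?p n + 2 * b\<^sup>2 * ?q n) summable_on UNIV"
    by (intro summable_on_add summable_on_cmult_right sobolevD(3) f g)
  then show "(\<lambda>n. weight r n * (norm (fourier_coeff (\<lambda>x. a * f x + b * g x) n))\<^sup>2) summable_on UNIV"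
  proof (rule summable_on_comparison_test)
    fix n
    have "norm (fourier_coeff (\<lambda>x. a * f x + b * g x) n) \<le> \<bar>a\<bar> * norm (fourier_coeff f n) + \<bar>b\<bar> * norm (fourier_coeff g n)"
      by (subst fourier_coeff_lincomb) (auto intro!: sobolevD[OF f] sobolevD[OF g] norm_triangle_le simp: norm_mult)
    then have "(norm (fourier_coeff (\<lambda>x. a * f x + b * g x) n))\<^sup>2 \<le> (\<bar>a\<bar> * norm (fourier_coeff f n) + \<bar>b\<bar> * norm (fourier_coeff g n))\<^sup>2"
      by (intro power_mono) auto
    also have "\<dots> \<le> 2 * (\<bar>a\<bar> * norm (fourier_coeff f n))\<^sup>2 + 2 * (\<bar>b\<bar> * norm (fourier_coeff g n))\<^sup>2"
      by (rule power2_sum_le)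
    finally have "weight r n * (norm (fourier_coeff (\<lambda>x. a * f x + b * g x) n))\<^sup>2 \<le>
       weight r n * (2 * (\<bar>a\<bar> * norm (fourier_coeff f n))\<^sup>2 + 2 * (\<bar>b\<bar> * norm (fourier_coeff g n))\<^sup>2)"
      by (intro mult_left_mono) auto
    then show "weight r n * (norm (fourier_coeff (\<lambda>x. a * f x + b * g x) n))\<^sup>2 \<le> 2 * a\<^sup>2 * ?p n + 2 * b\<^sup>2 * ?q n"
      by (simp add: power_mult_distrib algebra_simps)
  qed auto
qed

lemma continuous_on_has_vector_derivative:
  assumes "\<And>x. (F has_vector_derivative F' x) (at x)"
  shows "continuous_on S F"
  using assms by (meson continuous_at_imp_continuous_on has_vector_derivative_continuous)

text \<open>
  The increment of any antiderivative over one period has derivative \<open>0\<close>, and it equals the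
  mean of \<open>h\<close>, which is \<open>0\<close>. A constant is subtracted to normalize the mean of the
  antiderivative.
\<close>

lemma periodic_antiderivative:
  fixes h :: "real \<Rightarrow> 'a :: euclidean_space"
  assumes h: "continuous_on UNIV h" "\<And>x. h (x + 1) = h x" "integral {0..1} h = 0"
  obtains F where "\<And>x. (F has_vector_derivative h x) (at x)" "\<And>x. F (x + 1) = F x"
    "integral {0..1} F = 0"
proof -
  have "\<exists>F. \<forall>x. -\<infinity> < ereal x \<longrightarrow> ereal x < \<infinity> \<longrightarrow> (F has_vector_derivative h x) (at x)"
    by (rule einterval_antiderivative)
       (use h(1) in \<open>auto simp: continuous_on_eq_continuous_within\<close>)
  then obtain F where F: "(F has_vector_derivative h x) (at x)" for x by auto
  have "((\<lambda>x. F (x + 1) - F x) has_vector_derivative 0) (at x)" for x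
  proof -
    have "((F \<circ> (\<lambda>x. x + 1)) has_vector_derivative 1 *\<^sub>R h (x + 1)) (at x)"
      by (rule vector_diff_chain_at[OF _ F]) (auto intro!: derivative_eq_intros)
    from has_vector_derivative_diff[OF this F[of x]] show ?thesis
      by (simp add: o_def h)
  qed
  then obtain c where c: "\<And>x. F (x + 1) - F x = c"
    using has_vector_derivative_zero_constant[OF convex_UNIV, of "\<lambda>x. F (x + 1) - F x"] by auto
  have "(h has_integral F 1 - F 0) {0..1}"
    by (intro fundamental_theorem_of_calculus) (auto intro: F has_vector_derivative_at_within)
  then have "F 1 - F 0 = 0" using h(3) by (metis integral_unique)
  with c[of 0] have per: "F (x + 1) = F x" for x using c[of x] by simp
  have Fc: "continuous_on S F" for S
    using continuous_on_has_vector_derivative F by blast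
  define G where "G x = F x - integral {0..1} F" for x
  show ?thesis
  proof
    show "(G has_vector_derivative h x) (at x)" for x
      unfolding G_def using F[of x] by (auto intro!: derivative_eq_intros)
    show "G (x + 1) = G x" for x by (simp add: G_def per)
    have "integral {0..1} G = integral {0..1} F - integral {0..1} (\<lambda>x::real. integral {0..1} F)"
      unfolding G_def by (intro integral_diff integrable_continuous_real continuous_intros Fc)
    then show "integral {0..1} G = 0" by simp
  qed
qed

lemma fc_const: "fc (\<lambda>x. c) n = (if n = 0 then c else 0)"
  using integral_trig[of "-n"] by (simp add: fc_def)

lemma weight_deriv_coeff_le:
  assumes "c n = (2 * pi * of_int n * \<i>) * d n"
  shows "weight (r - 1) n * (norm (c n))\<^sup>2 \<le> (2 * pi)\<^sup>2 * (weight r n * (norm (d n))\<^sup>2)"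
proof -
  have "(norm (c n))\<^sup>2 = (2 * pi)\<^sup>2 * ((of_int n)\<^sup>2 * (norm (d n))\<^sup>2)"
    by (simp add: assms norm_mult power_mult_distrib)
  also have "\<dots> \<le> (2 * pi)\<^sup>2 * (weight 1 n * (norm (d n))\<^sup>2)"
    by (intro mult_left_mono mult_right_mono) (auto simp: weight_1)
  finally have "weight (r - 1) n * (norm (c n))\<^sup>2 \<le> weight (r - 1) n * ((2 * pi)\<^sup>2 * (weight 1 n * (norm (d n))\<^sup>2))"
    by (intro mult_left_mono) auto
  also have "\<dots> = (2 * pi)\<^sup>2 * (weight r n * (norm (d n))\<^sup>2)"
    using weight_add[of "r - 1" 1 n] by simp
  finally show ?thesis .
qed

text \<open>
  Term-by-term differentiation of the series is avoided: the formally differentiated series is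
  a continuous function \<open>g\<close>, its periodic antiderivative has the same Fourier coefficients as
  \<open>f\<close> apart from the one at frequency \<open>0\<close>, and hence differs from \<open>f\<close> by a constant.
\<close>

theorem sobolev_C1:
  assumes f: "f \<in> sobolev r" and r: "r > 3/2"
  shows sobolev_has_derivative: "(f has_real_derivative deriv f x) (at x)"
    and sobolev_deriv: "deriv f \<in> sobolev (r - 1)"
    and sobolev_norm_deriv: "sobolev_norm (r - 1) (deriv f) \<le> 2 * pi * sobolev_norm r f"
proof -
  define c where "c n = (2 * pi * of_int n * \<i>) * fourier_coeff f n" for n
  have le: "weight (r - 1) n * (norm (c n))\<^sup>2 \<le> (2 * pi)\<^sup>2 * (weight r n * (norm (fourier_coeff f n))\<^sup>2)" for n
    by (rule weight_deriv_coeff_le) (simp add: c_def)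
  have s: "(\<lambda>n. (2 * pi)\<^sup>2 * (weight r n * (norm (fourier_coeff f n))\<^sup>2)) summable_on UNIV"
    by (intro summable_on_cmult_right sobolevD(3) f)
  have c2: "(\<lambda>n. weight (r - 1) n * (norm (c n))\<^sup>2) summable_on UNIV"
    by (rule summable_on_comparison_test[OF s le]) auto
  have c1: "(\<lambda>n. norm (c n)) summable_on UNIV"
    using r by (intro weighted_l2_imp_l1(1)[OF _ c2]) auto
  define g where "g = trig_series c"
  have g: "continuous_on S g" "g (x + 1) = g x" "fc g n = c n" for S x n
    using continuous_on_trig_series[OF c1] trig_series_periodic[OF c1] fc_trig_series[OF c1]
    unfolding g_def by (auto intro: continuous_on_subset)
  have "integral {0..1} g = 0" using g(3)[of 0] by (simp add: fc_def c_def)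
  then obtain F where F: "\<And>x. (F has_vector_derivative g x) (at x)" "\<And>x. F (x + 1) = F x"
    using periodic_antiderivative[of g] g by metis
  have Fc: "continuous_on S F" for S
    using continuous_on_has_vector_derivative F by blast
  define d where "d = fourier_coeff f 0 - fc F 0"
  have "of_real (f x) - (F x + d) = 0" for x
  proof (rule fc_unique[where x = x])
    show "continuous_on UNIV (\<lambda>x. of_real (f x) - (F x + d))"
      by (intro continuous_intros Fc sobolevD[OF f])
    show "of_real (f (x + 1)) - (F (x + 1) + d) = of_real (f x) - (F x + d)" for x
      by (simp add: F sobolevD[OF f])
    fix n
    have "fc g n = (2 * pi * of_int n * \<i>) * fc F n"
      using F(2)[of 0] by (intro fc_derivative[OF F(1) g(1)]) auto
    then have "fc F n = fourier_coeff f n" if "n \<noteq> 0"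
      using that by (simp add: g c_def)
    moreover have "fc (\<lambda>x. of_real (f x) - (F x + d)) n = fourier_coeff f n - (fc F n + fc (\<lambda>x. d) n)"
    proof -
      have "fc (\<lambda>x. of_real (f x) - (F x + d)) n = fc (\<lambda>x. (of_real (f x) - F x) - d) n"
        by (simp add: algebra_simps)
      also have "\<dots> = fc (\<lambda>x. of_real (f x)) n - fc F n - fc (\<lambda>x. d) n"
        by (subst fc_diff | intro continuous_intros Fc sobolevD[OF f] refl)+
      finally show ?thesis by (simp add: fourier_coeff_eq_fc)
    qed
    ultimately show "fc (\<lambda>x. of_real (f x) - (F x + d)) n = 0"
      by (auto simp: fc_const d_def)
  qed
  then have fF: "complex_of_real (f x) = F x + d" for x by simp
  have D: "((\<lambda>x. complex_of_real (f x)) has_vector_derivative g x) (at x)" for x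
    unfolding fF using F(1)[of x] by (auto intro!: derivative_eq_intros)
  have fRe: "(f has_real_derivative Re (g x)) (at x)" for x
    using bounded_linear.has_vector_derivative[OF bounded_linear_Re D[of x]]
    by (simp add: has_real_derivative_iff_has_vector_derivative)
  have gIm: "Im (g x) = 0" for x
  proof -
    have "((\<lambda>x. 0::real) has_vector_derivative Im (g x)) (at x)"
      using bounded_linear.has_vector_derivative[OF bounded_linear_Im D[of x]] by simp
    then show ?thesis using vector_derivative_unique_at has_vector_derivative_const by blast
  qed
  have df: "deriv f x = Re (g x)" for x using fRe DERIV_imp_deriv by blast
  show "(f has_real_derivative deriv f x) (at x)" using fRe df by simp
  have dg: "complex_of_real (deriv f x) = g x" for x
    using df gIm by (simp add: complex_eq_iff)
  have fcd: "fourier_coeff (deriv f) n = c n" for n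
    unfolding fourier_coeff_eq_fc dg using g(3) .
  show "deriv f \<in> sobolev (r - 1)"
    unfolding mem_sobolev_iff fcd using c2 g
    by (auto simp: df [abs_def] intro!: continuous_intros)
  have "sobolev_norm (r - 1) (deriv f) \<le> sqrt (\<Sum>\<^sub>\<infinity>n. (2 * pi)\<^sup>2 * (weight r n * (norm (fourier_coeff f n))\<^sup>2))"
    unfolding sobolev_norm_eq fcd by (intro real_sqrt_le_mono infsum_mono c2 s le)
  also have "\<dots> = sqrt ((2 * pi)\<^sup>2) * sobolev_norm r f"
    unfolding sobolev_norm_eq by (subst infsum_cmult_right') (simp add: real_sqrt_mult)
  finally show "sobolev_norm (r - 1) (deriv f) \<le> 2 * pi * sobolev_norm r f"
    by (simp add: real_sqrt_unique[of "2 * pi"])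
qed

text \<open>
  Either \<open>k\<close> or \<open>n - k\<close> has at least half the size of \<open>n\<close>. This lets the weight of a product
  be put on one of the two factors.
\<close>

lemma weight_quasi_subadditive:
  assumes "r \<ge> 0"
  shows "weight r n \<le> 4 powr r * (weight r k + weight r (n - k))"
proof -
  define K where "K = max (1 + (real_of_int k)\<^sup>2) (1 + (real_of_int (n - k))\<^sup>2)"
  have "(real_of_int n)\<^sup>2 \<le> 2 * (real_of_int k)\<^sup>2 + 2 * (real_of_int (n - k))\<^sup>2"
    using sum_squares_bound[of "real_of_int k" "real_of_int (n - k)"]
      power2_sum[of "real_of_int k" "real_of_int (n - k)"] by simp
  moreover have "1 + (real_of_int k)\<^sup>2 \<le> K" "1 + (real_of_int (n - k))\<^sup>2 \<le> K"
    by (simp_all add: K_def)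
  ultimately have "1 + (real_of_int n)\<^sup>2 \<le> 4 * K" by linarith
  then have "weight r n \<le> (4 * K) powr r"
    unfolding weight_def using assms by (intro powr_mono2) (auto simp: add_nonneg_nonneg)
  also have "\<dots> = 4 powr r * K powr r" by (intro powr_mult) 
  also have "K powr r \<le> weight r k + weight r (n - k)"
    unfolding K_def max_def using weight_nonneg[of r k] weight_nonneg[of r "n - k"] by (auto simp: weight_def)
  finally show ?thesis by simp
qed

lemma has_sum_finite_sum:
  fixes f :: "'n \<Rightarrow> 'k \<Rightarrow> real"
  assumes "finite N" "\<And>n. n \<in> N \<Longrightarrow> f n summable_on A"
  shows "((\<lambda>k. \<Sum>n\<in>N. f n k) has_sum (\<Sum>n\<in>N. infsum (f n) A)) A"
  using assms by (induction N rule: finite_induct) (auto intro: has_sum_add)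

text \<open>
  Young's inequality for convolutions: by Cauchy-Schwarz with respect to the weights \<open>a\<close>, \<open>(\<Sum>
  a\<^sub>k b\<^bsub>n-k\<^esub>)\<^sup>2 \<le> (\<Sum> a\<^sub>k) (\<Sum> a\<^sub>k b\<^bsub>n-k\<^esub>\<^sup>2)\<close>, and the right-hand side is summed over \<open>n\<close>
  first.
\<close>

lemma young_l1_l2:
  fixes a b :: "int \<Rightarrow> real"
  assumes a: "\<And>n. a n \<ge> 0" "a summable_on UNIV"
    and b: "(\<lambda>n. (b n)\<^sup>2) summable_on UNIV"
  shows "(\<lambda>k. \<bar>a k * b (n - k)\<bar>) summable_on UNIV"
    and "(\<lambda>n. (\<Sum>\<^sub>\<infinity>k. \<bar>a k * b (n - k)\<bar>)\<^sup>2) summable_on UNIV"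
proof -
  define A B where "A = infsum a UNIV" and "B = (\<Sum>\<^sub>\<infinity>n. (b n)\<^sup>2)"
  have b': "(\<lambda>n. (b (n - k))\<^sup>2) summable_on UNIV" "(\<Sum>\<^sub>\<infinity>n. (b (n - k))\<^sup>2) = B" for k
    using b summable_on_reindex_bij_witness[of UNIV "\<lambda>n. n + k" "\<lambda>n. n - k" UNIV "\<lambda>n. (b n)\<^sup>2" "\<lambda>n. (b (n - k))\<^sup>2"]
      infsum_reindex_bij_witness[of UNIV "\<lambda>n. n + k" "\<lambda>n. n - k" UNIV "\<lambda>n. (b n)\<^sup>2" "\<lambda>n. (b (n - k))\<^sup>2"]
    by (auto simp: B_def)
  have bB: "(b m)\<^sup>2 \<le> B" for m
    using finite_sum_le_infsum[OF b, of "{m}"] by (simp add: B_def)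
  have A0: "A \<ge> 0" unfolding A_def by (intro infsum_nonneg a)
  have ab: "(\<lambda>k. a k * (b (n - k))\<^sup>2) summable_on UNIV" for n
    by (rule summable_on_comparison_test[OF summable_on_cmult_left[OF a(2), of B]])
       (auto intro!: mult_left_mono mult_nonneg_nonneg a bB)
  have sa: "(\<lambda>k. (sqrt (a k))\<^sup>2) summable_on UNIV" using a by simp
  have sb: "(\<lambda>k. (sqrt (a k) * b (n - k))\<^sup>2) summable_on UNIV" for n
    using ab a by (simp add: power_mult_distrib)
  have eq: "\<bar>sqrt (a k) * (sqrt (a k) * b (n - k))\<bar> = \<bar>a k * b (n - k)\<bar>" for k n
    using a(1)[of k] by (simp add: abs_mult flip: mult.assoc)
  note CS = infsum_Cauchy_Schwarz[OF sa sb, unfolded eq]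
  show "(\<lambda>k. \<bar>a k * b (n - k)\<bar>) summable_on UNIV" by (rule CS)
  have sq: "(\<Sum>\<^sub>\<infinity>k. \<bar>a k * b (n - k)\<bar>)\<^sup>2 \<le> A * (\<Sum>\<^sub>\<infinity>k. a k * (b (n - k))\<^sup>2)" for n
  proof -
    have "(\<Sum>\<^sub>\<infinity>k. \<bar>a k * b (n - k)\<bar>)\<^sup>2 \<le>
       (sqrt (\<Sum>\<^sub>\<infinity>k. (sqrt (a k))\<^sup>2) * sqrt (\<Sum>\<^sub>\<infinity>k. (sqrt (a k) * b (n - k))\<^sup>2))\<^sup>2"
      by (intro power_mono CS infsum_nonneg) auto
    also have "\<dots> = (sqrt A)\<^sup>2 * (sqrt (\<Sum>\<^sub>\<infinity>k. a k * (b (n - k))\<^sup>2))\<^sup>2"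
      using a by (simp add: A_def power_mult_distrib)
    also have "\<dots> = A * (\<Sum>\<^sub>\<infinity>k. a k * (b (n - k))\<^sup>2)"
      using A0 by (simp add: infsum_nonneg a)
    finally show ?thesis .
  qed
  show "(\<lambda>n. (\<Sum>\<^sub>\<infinity>k. \<bar>a k * b (n - k)\<bar>)\<^sup>2) summable_on UNIV"
  proof (rule nonneg_bdd_above_summable_on)
    show "bdd_above (sum (\<lambda>n. (\<Sum>\<^sub>\<infinity>k. \<bar>a k * b (n - k)\<bar>)\<^sup>2) ` {F. F \<subseteq> UNIV \<and> finite F})"
    proof (rule bdd_aboveI, clarify)
      fix N :: "int set" assume N: "finite N"
      have "(\<Sum>n\<in>N. (\<Sum>\<^sub>\<infinity>k. \<bar>a k * b (n - k)\<bar>)\<^sup>2) \<le> (\<Sum>n\<in>N. A * (\<Sum>\<^sub>\<infinity>k. a k * (b (n - k))\<^sup>2))"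
        by (intro sum_mono sq)
      also have "\<dots> = A * (\<Sum>\<^sub>\<infinity>k. \<Sum>n\<in>N. a k * (b (n - k))\<^sup>2)"
        using infsumI[OF has_sum_finite_sum[OF N ab]] by (simp add: sum_distrib_left)
      also have "(\<Sum>\<^sub>\<infinity>k. \<Sum>n\<in>N. a k * (b (n - k))\<^sup>2) \<le> (\<Sum>\<^sub>\<infinity>k. a k * B)"
      proof (rule infsum_mono)
        show "(\<lambda>k. \<Sum>n\<in>N. a k * (b (n - k))\<^sup>2) summable_on UNIV"
          using has_sum_finite_sum[OF N ab] by (rule has_sum_imp_summable)
        show "(\<lambda>k. a k * B) summable_on UNIV" by (intro summable_on_cmult_left a)
        show "(\<Sum>n\<in>N. a k * (b (n - k))\<^sup>2) \<le> a k * B" for k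
          unfolding sum_distrib_left [symmetric]
          using finite_sum_le_infsum[OF b'(1)[of k] N] a(1)[of k] by (intro mult_left_mono) (auto simp: b')
      qed
      finally show "(\<Sum>n\<in>N. (\<Sum>\<^sub>\<infinity>k. \<bar>a k * b (n - k)\<bar>)\<^sup>2) \<le> A * (\<Sum>\<^sub>\<infinity>k. a k * B)"
        using A0 by (simp add: mult_left_mono)
    qed
  qed auto
qed

text \<open>
  For \<open>r > 1/2\<close> the space \<open>H\<^sup>r\<close> is an algebra; this is the case of squares. The coefficients
  of the square are the convolution of an absolutely summable sequence with itself, and the
  weight is moved to one factor, which leaves a convolution of an \<open>l\<^sup>1\<close> with an \<open>l\<^sup>2\<close>
  sequence.
\<close>

theorem sobolev_square:
  assumes g: "g \<in> sobolev r" and r: "r > 1/2"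
  shows "(\<lambda>x. (g x)\<^sup>2) \<in> sobolev r"
  unfolding mem_sobolev_iff
proof (intro conjI allI)
  show "continuous_on UNIV (\<lambda>x. (g x)\<^sup>2)" by (intro continuous_intros sobolevD[OF g])
  show "(g (x + 1))\<^sup>2 = (g x)\<^sup>2" for x by (simp add: sobolevD[OF g])
  define a where "a n = norm (fourier_coeff g n)" for n
  define b where "b n = weight (r / 2) n * a n" for n
  have a: "a n \<ge> 0" "a summable_on UNIV" for n
    using sobolev_fourier_series(1)[OF g r] by (auto simp: a_def [abs_def])
  have b: "(\<lambda>n. (b n)\<^sup>2) summable_on UNIV"
    unfolding b_def a_def power_mult_distrib weight_half by (rule sobolevD[OF g])
  have b0: "b n \<ge> 0" for n by (simp add: b_def a)
  define S where "S n = (\<Sum>\<^sub>\<infinity>k. \<bar>a k * b (n - k)\<bar>)" for n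
  note Y = young_l1_l2[OF a b, folded S_def]
  have S: "((\<lambda>k. a k * b (n - k)) has_sum S n) UNIV" for n
    using has_sum_infsum[OF Y(1)[of n]] a b0 by (simp add: S_def abs_mult)
  have S': "((\<lambda>k. b k * a (n - k)) has_sum S n) UNIV" for n
  proof -
    have "((\<lambda>k. a k * b (n - k)) has_sum S n) UNIV \<longleftrightarrow> ((\<lambda>k. b k * a (n - k)) has_sum S n) UNIV"
      by (rule has_sum_reindex_bij_witness[of _ "\<lambda>k. n - k" "\<lambda>k. n - k"]) auto
    with S show ?thesis by blast
  qed
  define C where "C = 4 powr (r / 2)"
  have bound: "weight (r / 2) n * norm (fourier_coeff (\<lambda>x. (g x)\<^sup>2) n) \<le> C * (2 * S n)" for n
  proof -
    have "((\<lambda>k. fourier_coeff g k * fourier_coeff g (n - k)) has_sum fourier_coeff (\<lambda>x. (g x)\<^sup>2) n) UNIV"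
      unfolding fourier_coeff_eq_fc power2_eq_square of_real_mult
      using sobolev_fourier_series(1)[OF g r]
      by (intro fc_mult_has_sum continuous_intros sobolevD[OF g])
         (auto simp: sobolevD[OF g] fourier_coeff_eq_fc)
    from has_sum_cmult_right[OF this, of "of_real (weight (r / 2) n)"]
    have 1: "((\<lambda>k. of_real (weight (r / 2) n) * (fourier_coeff g k * fourier_coeff g (n - k)))
       has_sum of_real (weight (r / 2) n) * fourier_coeff (\<lambda>x. (g x)\<^sup>2) n) UNIV" .
    have 2: "((\<lambda>k. C * (b k * a (n - k) + a k * b (n - k))) has_sum C * (S n + S n)) UNIV"
      by (intro has_sum_cmult_right has_sum_add S S')
    have 3: "norm (of_real (weight (r / 2) n) * (fourier_coeff g k * fourier_coeff g (n - k)))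
        \<le> C * (b k * a (n - k) + a k * b (n - k))" for k
    proof -
      have "weight (r / 2) n * (a k * a (n - k)) \<le> (C * (weight (r / 2) k + weight (r / 2) (n - k))) * (a k * a (n - k))"
        unfolding C_def using r by (intro mult_right_mono weight_quasi_subadditive) (auto simp: a)
      then show ?thesis
        by (simp add: norm_mult a_def [symmetric] b_def algebra_simps)
    qed
    have "norm (of_real (weight (r / 2) n) * fourier_coeff (\<lambda>x. (g x)\<^sup>2) n) \<le> C * (S n + S n)"
      by (rule norm_infsum_le[OF 1 2 3])
    then show ?thesis by (simp add: norm_mult)
  qed
  have "(\<lambda>n. (C * 2)\<^sup>2 * (S n)\<^sup>2) summable_on UNIV"
    by (intro summable_on_cmult_right Y)
  then show "(\<lambda>n. weight r n * (norm (fourier_coeff (\<lambda>x. (g x)\<^sup>2) n))\<^sup>2) summable_on UNIV"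
  proof (rule summable_on_comparison_test)
    fix n
    have "(weight (r / 2) n * norm (fourier_coeff (\<lambda>x. (g x)\<^sup>2) n))\<^sup>2 \<le> (C * (2 * S n))\<^sup>2"
      by (intro power_mono bound) auto
    then show "weight r n * (norm (fourier_coeff (\<lambda>x. (g x)\<^sup>2) n))\<^sup>2 \<le> (C * 2)\<^sup>2 * (S n)\<^sup>2"
      by (simp add: power_mult_distrib weight_half)
  qed auto
qed

section \<open>Inverting the operator\<close>

text \<open>
  Integrating \<open>mean f - f\<close> twice, with constants of integration that keep the primitives
  periodic and give the result the mean of \<open>f\<close>, solves \<open>mean w - w'' = f\<close>. For \<open>n \<noteq> 0\<close> the
  Fourier coefficients of \<open>w\<close> are those of \<open>f\<close> divided by \<open>(2 \<pi> n)\<^sup>2\<close>, which is the gain of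
  two derivatives.
\<close>

theorem A_op_surj:
  assumes f: "f \<in> sobolev r"
  shows "f \<in> A_op ` sobolev (r + 2)"
proof -
  define m where "m = mean f"
  define h where "h x = m - f x" for x
  have fc': "continuous_on S f" for S by (rule sobolevD[OF f])
  have h: "continuous_on S h" "h (x + 1) = h x" for S x
    unfolding h_def by (auto intro!: continuous_intros sobolevD[OF f] simp: sobolevD[OF f])
  have "integral {0..1} h = integral {0..1} (\<lambda>x::real. m) - integral {0..1} f"
    unfolding h_def by (intro integral_diff integrable_continuous_real continuous_intros fc')
  then have "integral {0..1} h = 0" by (simp add: m_def mean_def)
  then obtain F where F: "\<And>x. (F has_vector_derivative h x) (at x)" "\<And>x. F (x + 1) = F x"
    "integral {0..1} F = 0"
    using periodic_antiderivative[of h] h by metis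
  note Fc = continuous_on_has_vector_derivative[OF F(1)]
  obtain G where G: "\<And>x. (G has_vector_derivative F x) (at x)" "\<And>x. G (x + 1) = G x"
    "integral {0..1} G = 0"
    using periodic_antiderivative[of F] F Fc by metis
  note Gc = continuous_on_has_vector_derivative[OF G(1)]
  define w where "w x = G x + m" for x
  have w': "(w has_real_derivative F x) (at x)" for x
    unfolding w_def has_real_derivative_iff_has_vector_derivative
    using G(1)[of x] by (auto intro!: derivative_eq_intros)
  have wc: "continuous_on S w" for S unfolding w_def by (intro continuous_intros Gc)
  have "deriv w = F" using w' DERIV_imp_deriv by blast
  moreover have "deriv F = h"
    using F(1) by (intro ext DERIV_imp_deriv) (simp add: has_real_derivative_iff_has_vector_derivative)
  moreover have "mean w = m"
  proof -
    have "mean w = integral {0..1} G + integral {0..1} (\<lambda>x::real. m)"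
      unfolding mean_def w_def by (intro integral_add integrable_continuous_real continuous_intros Gc)
    then show ?thesis using G by simp
  qed
  ultimately have Aw: "A_op w = f" by (simp add: A_op_def h_def)
  have lift: "((\<lambda>x. complex_of_real (\<phi> x)) has_vector_derivative of_real (\<psi> x)) (at x)"
    if "(\<phi> has_vector_derivative \<psi> x) (at x)" for \<phi> \<psi> :: "real \<Rightarrow> real" and x
    using bounded_linear.has_vector_derivative[OF bounded_linear_of_real that] .
  have coeff: "fourier_coeff h n = (2 * pi * of_int n * \<i>) * ((2 * pi * of_int n * \<i>) * fourier_coeff w n)" for n
  proof -
    have "fourier_coeff h n = (2 * pi * of_int n * \<i>) * fourier_coeff F n"
      unfolding fourier_coeff_eq_fc using F(2)[of 0]
      by (intro fc_derivative lift F continuous_intros h) auto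
    also have "fourier_coeff F n = (2 * pi * of_int n * \<i>) * fourier_coeff w n"
      unfolding fourier_coeff_eq_fc using G(2)[of 0]
      by (intro fc_derivative lift w'[unfolded has_real_derivative_iff_has_vector_derivative] continuous_intros Fc)
         (auto simp: w_def)
    finally show ?thesis .
  qed
  have hf: "fourier_coeff h n = - fourier_coeff f n" if "n \<noteq> 0" for n
  proof -
    have "fourier_coeff h n = fc (\<lambda>x. of_real m) n - fc (\<lambda>x. of_real (f x)) n"
      unfolding fourier_coeff_eq_fc h_def of_real_diff by (intro fc_diff continuous_intros fc')
    then show ?thesis using that by (simp add: fc_const fourier_coeff_eq_fc)
  qed
  have le: "weight (r + 2) n * (norm (fourier_coeff w n))\<^sup>2 \<le> weight r n * (norm (fourier_coeff f n))\<^sup>2" if n: "n \<noteq> 0" for n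
  proof -
    have "norm (fourier_coeff f n) = norm (fourier_coeff h n)" using hf[OF n] by simp
    also have "\<dots> = (2 * pi)\<^sup>2 * (real_of_int n)\<^sup>2 * norm (fourier_coeff w n)"
      unfolding coeff by (simp add: norm_mult power2_eq_square)
    also have "\<dots> \<ge> weight 1 n * norm (fourier_coeff w n)"
    proof (intro mult_right_mono)
      have 1: "1 \<le> (real_of_int n)\<^sup>2" using n
        by (metis int_one_le_iff_zero_less of_int_1_le_iff of_int_power zero_less_power2)
      have "2\<^sup>2 \<le> (2 * pi)\<^sup>2" using pi_ge_two by (intro power_mono) auto
      then have "2 \<le> (2 * pi)\<^sup>2" by (rule order_trans[rotated]) simp
      then have "2 * (real_of_int n)\<^sup>2 \<le> (2 * pi)\<^sup>2 * (real_of_int n)\<^sup>2" by (intro mult_right_mono) auto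
      with 1 show "weight 1 n \<le> (2 * pi)\<^sup>2 * (real_of_int n)\<^sup>2" by (simp add: weight_1)
    qed auto
    finally have "(weight 1 n * norm (fourier_coeff w n))\<^sup>2 \<le> (norm (fourier_coeff f n))\<^sup>2"
      by (intro power_mono) auto
    then have "weight r n * (weight 1 n * norm (fourier_coeff w n))\<^sup>2 \<le> weight r n * (norm (fourier_coeff f n))\<^sup>2"
      by (intro mult_left_mono) auto
    moreover have "weight (r + 2) n = weight r n * (weight 1 n)\<^sup>2"
      using weight_add[of r 2 n] weight_half[of 2 n] by simp
    ultimately show ?thesis by (simp add: power_mult_distrib)
  qed
  have "(\<lambda>n. weight (r + 2) n * (norm (fourier_coeff w n))\<^sup>2) summable_on (UNIV - {0})"
    by (rule summable_on_comparison_test[OF summable_on_subset_banach[OF sobolevD(3)[OF f]]]) (auto intro: le)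
  then have "(\<lambda>n. weight (r + 2) n * (norm (fourier_coeff w n))\<^sup>2) summable_on insert 0 (UNIV - {0})"
    by (subst summable_on_insert_iff) auto
  then have "w \<in> sobolev (r + 2)"
    unfolding mem_sobolev_iff using wc G(2) by (auto simp: w_def)
  with Aw show ?thesis by blast
qed

text \<open>
  \<open>A_inv\<close> picks some preimage under \<open>A_op\<close>. Since every element of \<open>H\<^bsup>r+2\<^esup>\<close> is \<open>C\<^sup>2\<close>, the
  equation \<open>mean w - w'' = f\<close> then holds classically for the chosen \<open>w\<close>, and integrating it
  over a period shows that \<open>w\<close> has the mean of \<open>f\<close>.
\<close>

theorem A_inv_solves:
  assumes f: "f \<in> sobolev r" and r: "r > 1/2"
  defines "w \<equiv> A_inv r f"
  shows "w (x + 1) = w x" "(w has_real_derivative deriv w x) (at x)"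
    "deriv w (x + 1) = deriv w x" "(deriv w has_real_derivative mean f - f x) (at x)"
proof -
  have wS: "w \<in> sobolev (r + 2)" and Aw: "A_op w = f"
    unfolding w_def A_inv_def using inv_into_into f_inv_into_f A_op_surj[OF f] by metis+
  have dS: "deriv w \<in> sobolev (r + 1)" using sobolev_deriv[OF wS] r by (simp add: add.commute)
  have D2: "(deriv w has_real_derivative deriv (deriv w) x) (at x)" for x
    using sobolev_has_derivative[OF dS] r by simp
  have ddS: "deriv (deriv w) \<in> sobolev r" using sobolev_deriv[OF dS] r by simp
  show "w (x + 1) = w x" "deriv w (x + 1) = deriv w x" using sobolevD wS dS by blast+
  show "(w has_real_derivative deriv w x) (at x)" using sobolev_has_derivative[OF wS] r by simp
  have "(deriv (deriv w) has_integral deriv w 1 - deriv w 0) {0..1}"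
    by (intro fundamental_theorem_of_calculus)
       (use D2 in \<open>auto simp: has_real_derivative_iff_has_vector_derivative intro: has_vector_derivative_at_within\<close>)
  then have "integral {0..1} (deriv (deriv w)) = 0"
    using sobolevD(2)[OF dS, of 0] by (simp add: integral_unique)
  moreover have "mean f = integral {0..1} (\<lambda>x. mean w - deriv (deriv w) x)"
    using Aw by (simp add: mean_def[of f] A_op_def)
  moreover have "\<dots> = integral {0..1} (\<lambda>x::real. mean w) - integral {0..1} (deriv (deriv w))"
    by (intro integral_diff integrable_continuous_real continuous_intros sobolevD[OF ddS])
  ultimately have "mean f = mean w" by simp
  moreover have "f x = mean w - deriv (deriv w) x" using Aw by (auto simp: A_op_def)
  ultimately show "(deriv w has_real_derivative mean f - f x) (at x)" using D2[of x] by simp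
qed

section \<open>Inequalities for periodic functions\<close>

lemma integral_Cauchy_Schwarz:
  fixes f g :: "real \<Rightarrow> real"
  assumes f: "continuous_on {0..1} f" and g: "continuous_on {0..1} g"
  shows "(integral {0..1} (\<lambda>x. f x * g x))\<^sup>2 \<le> integral {0..1} (\<lambda>x. (f x)\<^sup>2) * integral {0..1} (\<lambda>x. (g x)\<^sup>2)"
proof -
  define A B C where "A = integral {0..1} (\<lambda>x. (f x)\<^sup>2)" and "B = integral {0..1} (\<lambda>x. f x * g x)"
    and "C = integral {0..1} (\<lambda>x. (g x)\<^sup>2)"
  have A0: "A \<ge> 0" unfolding A_def
    by (intro integral_nonneg integrable_continuous_real continuous_intros f) auto
  have hA: "((\<lambda>x. (f x)\<^sup>2) has_integral A) {0..1}" and hB: "((\<lambda>x. f x * g x) has_integral B) {0..1}"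
    and hC: "((\<lambda>x. (g x)\<^sup>2) has_integral C) {0..1}"
    unfolding A_def B_def C_def
    by (intro integrable_integral integrable_continuous_real continuous_intros f g)+
  \<comment> \<open>Integrate \<open>(A g - B f)\<^sup>2 \<ge> 0\<close>.\<close>
  have "((\<lambda>x. A\<^sup>2 * (g x)\<^sup>2 - 2 * A * B * (f x * g x) + B\<^sup>2 * (f x)\<^sup>2) has_integral
      A\<^sup>2 * C - 2 * A * B * B + B\<^sup>2 * A) {0..1}"
    by (intro has_integral_add has_integral_diff has_integral_mult_right hA hB hC)
  moreover have "A\<^sup>2 * (g x)\<^sup>2 - 2 * A * B * (f x * g x) + B\<^sup>2 * (f x)\<^sup>2 = (A * g x - B * f x)\<^sup>2" for x
    by (simp add: power2_eq_square algebra_simps)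
  ultimately have "((\<lambda>x. (A * g x - B * f x)\<^sup>2) has_integral A * (A * C - B\<^sup>2)) {0..1}"
    by (simp add: power2_eq_square algebra_simps)
  then have nn: "0 \<le> A * (A * C - B\<^sup>2)" by (rule has_integral_nonneg) simp
  have "B\<^sup>2 \<le> A * C"
  proof (cases "A = 0")
    case True
    then have "f x = 0" if "x \<in> {0..1}" for x
      using integral_continuous_nonneg_eq_0[of "\<lambda>x. (f x)\<^sup>2" x] that f
      by (auto simp: A_def intro: continuous_intros)
    then have "B = integral {0..1} (\<lambda>x::real. 0::real)" unfolding B_def
      by (intro integral_cong) simp
    with True show ?thesis by simp
  next
    case False
    with A0 nn show ?thesis by (simp add: zero_le_mult_iff)
  qed
  then show ?thesis by (simp add: A_def B_def C_def)
qed

lemma integral_periodic_shift: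
  fixes g :: "real \<Rightarrow> real"
  assumes g: "continuous_on UNIV g" "\<And>x. g (x + 1) = g x"
  shows "integral {0..1} (\<lambda>y. g (x + y)) = integral {0..1} g"
proof -
  define m where "m = integral {0..1} g"
  have gc: "continuous_on S g" for S using g continuous_on_subset by blast
  have "integral {0..1} (\<lambda>x. g x - m) = integral {0..1} g - integral {0..1} (\<lambda>x::real. m)"
    by (intro integral_diff integrable_continuous_real continuous_intros gc)
  then have "integral {0..1} (\<lambda>x. g x - m) = 0" by (simp add: m_def)
  moreover have "continuous_on UNIV (\<lambda>x. g x - m)" by (intro continuous_intros gc)
  moreover have "g (x + 1) - m = g x - m" for x by (simp add: g)
  ultimately obtain F where F: "\<And>x. (F has_vector_derivative g x - m) (at x)" "\<And>x. F (x + 1) = F x"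
    using periodic_antiderivative[of "\<lambda>x. g x - m"] by metis
  have "((\<lambda>y. F (x + y)) has_vector_derivative 1 * (g (x + y) - m)) (at y)" for y
    using F(1)[of "x + y"] DERIV_shift[of F "g (x + y) - m" y x]
    by (simp add: has_real_derivative_iff_has_vector_derivative add.commute)
  then have "((\<lambda>y. 1 * (g (x + y) - m)) has_integral F (x + 1) - F (x + 0)) {0..1}"
    by (intro fundamental_theorem_of_calculus) (auto intro: has_vector_derivative_at_within)
  then have "integral {0..1} (\<lambda>y. g (x + y) - m) = 0" by (simp add: F(2) integral_unique)
  moreover have "integral {0..1} (\<lambda>y. g (x + y) - m) = integral {0..1} (\<lambda>y. g (x + y)) - integral {0..1} (\<lambda>x::real. m)"
    by (intro integral_diff integrable_continuous_real continuous_intros continuous_on_compose2[OF g(1)]) auto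
  ultimately show ?thesis by (simp add: m_def)
qed

lemma continuous_on_DERIV:
  assumes "\<And>x. (f has_real_derivative f' x) (at x)"
  shows "continuous_on S f"
  using assms by (meson DERIV_isCont continuous_at_imp_continuous_on)

lemma FTC_unit:
  assumes "\<And>x. (f has_real_derivative f' x) (at x)"
  shows "(f' has_integral f 1 - f (0::real)) {0..1}"
  using assms
  by (intro fundamental_theorem_of_calculus)
     (auto simp: has_real_derivative_iff_has_vector_derivative intro: has_vector_derivative_at_within)

text \<open>
  Integration by parts represents \<open>f x - mean f\<close> as the integral of \<open>(y - 1/2) f' (x + y)\<close>
  over one period: the kernel jumps by \<open>1\<close> at the end points, which produces the value \<open>f x\<close>.
  The constant is the \<open>L\<^sup>2\<close> norm \<open>1 / sqrt 12\<close> of the kernel.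
\<close>

theorem deviation_from_mean_bound:
  assumes f: "\<And>x. (f has_real_derivative f' x) (at x)" "\<And>x. f (x + 1) = f x"
    and f': "continuous_on UNIV f'" "\<And>x. f' (x + 1) = f' x"
  shows "\<bar>f x - mean f\<bar> \<le> sqrt 3 / 6 * sqrt (integral {0..1} (\<lambda>x. (f' x)\<^sup>2))"
proof -
  define E where "E = integral {0..1} (\<lambda>x. (f' x)\<^sup>2)"
  note fc' = continuous_on_DERIV[OF f(1)]
  have f'c: "continuous_on S (\<lambda>y. f' (x + y))" for S
    by (intro continuous_on_compose2[OF f'(1)] continuous_intros) auto
  have fxc: "continuous_on S (\<lambda>y. f (x + y))" for S
    by (intro continuous_on_compose2[OF fc'[of UNIV]] continuous_intros) auto
  have "((\<lambda>y. (y - 1/2) * f (x + y)) has_real_derivative f (x + y) + (y - 1/2) * f' (x + y)) (at y)" for y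
  proof -
    have "((\<lambda>y. f (x + y)) has_real_derivative f' (x + y) * 1) (at y)"
      by (rule DERIV_chain2[OF f(1)]) (auto intro!: derivative_eq_intros)
    then show ?thesis by (auto intro!: derivative_eq_intros)
  qed
  note integral_unique[OF FTC_unit[OF this]]
  then have "integral {0..1} (\<lambda>y. f (x + y) + (y - 1/2) * f' (x + y)) = f x"
    by (simp only: f(2)) simp
  moreover have "integral {0..1} (\<lambda>y. f (x + y) + (y - 1/2) * f' (x + y)) =
     integral {0..1} (\<lambda>y. f (x + y)) + integral {0..1} (\<lambda>y. (y - 1/2) * f' (x + y))"
    by (intro integral_add integrable_continuous_real continuous_intros f'c fxc)
  ultimately have eq: "f x - mean f = integral {0..1} (\<lambda>y. (y - 1/2) * f' (x + y))"
    using integral_periodic_shift[OF fc' f(2), of x] by (simp add: mean_def)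
  have "((\<lambda>y. (y - 1/2)\<^sup>2) has_integral (1 - 1/2) ^ 3 / 3 - (0 - 1/2) ^ 3 / (3::real)) {0..1}"
    by (rule FTC_unit) (auto intro!: derivative_eq_intros simp: power2_eq_square)
  then have i12: "integral {0..1} (\<lambda>y. (y - 1/2)\<^sup>2) = (1/12 :: real)"
    by (simp add: integral_unique power3_eq_cube)
  have "(f x - mean f)\<^sup>2 \<le> integral {0..1} (\<lambda>y. (y - 1/2)\<^sup>2) * integral {0..1} (\<lambda>y. (f' (x + y))\<^sup>2)"
    unfolding eq by (intro integral_Cauchy_Schwarz continuous_intros f'c)
  also have "integral {0..1} (\<lambda>y. (f' (x + y))\<^sup>2) = E"
    unfolding E_def by (rule integral_periodic_shift) (auto intro!: continuous_intros f' simp: f')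
  finally have "(f x - mean f)\<^sup>2 \<le> (1/12) * E" unfolding i12 .
  then have "sqrt ((f x - mean f)\<^sup>2) \<le> sqrt ((1/12) * E)" by (rule real_sqrt_le_mono)
  moreover have "sqrt (1/12 :: real) = sqrt 3 / 6"
    by (rule real_sqrt_unique) (auto simp: power_divide)
  ultimately show ?thesis by (simp only: real_sqrt_mult real_sqrt_abs E_def)
qed

section \<open>Moments of the slope under transport\<close>

text \<open>
  Sobolev embedding controls a curve of functions in the supremum norm, while differentiation
  under the integral sign asks for joint continuity in time and space; this passes from the
  former to the latter.
\<close>

lemma joint_continuity:
  fixes u :: "real \<Rightarrow> real \<Rightarrow> real"
  assumes N: "\<And>t. t \<in> J \<Longrightarrow> ((\<lambda>\<tau>. N t \<tau>) \<longlongrightarrow> 0) (at t within J)"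
    and le: "\<And>t \<tau> y. t \<in> J \<Longrightarrow> \<tau> \<in> J \<Longrightarrow> \<bar>u \<tau> y - u t y\<bar> \<le> N t \<tau>"
    and c: "\<And>t. t \<in> J \<Longrightarrow> continuous_on UNIV (u t)"
  shows "continuous_on (J \<times> UNIV) (\<lambda>p. u (fst p) (snd p))"
  unfolding continuous_on_iff
proof (clarify)
  fix t x e :: real assume t: "t \<in> J" and e: "e > 0"
  from tendstoD[OF N[OF t], of "e/2"] e
  obtain d1 where d1: "d1 > 0" "\<And>\<tau>. \<tau> \<in> J \<Longrightarrow> \<tau> \<noteq> t \<Longrightarrow> dist \<tau> t < d1 \<Longrightarrow> \<bar>N t \<tau>\<bar> < e/2"
    by (auto simp: eventually_at)
  from c[OF t] e obtain d2 where d2: "d2 > 0" "\<And>y. dist y x < d2 \<Longrightarrow> dist (u t y) (u t x) < e/2"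
    unfolding continuous_on_iff by (metis UNIV_I half_gt_zero)
  show "\<exists>d>0. \<forall>p\<in>J \<times> UNIV. dist p (t, x) < d \<longrightarrow>
     dist (u (fst p) (snd p)) (u (fst (t, x)) (snd (t, x))) < e"
  proof (intro exI[of _ "min d1 d2"] conjI ballI impI)
    fix p assume p: "p \<in> J \<times> (UNIV :: real set)" "dist p (t, x) < min d1 d2"
    obtain \<tau> y where py: "p = (\<tau>, y)" by force
    have \<tau>: "\<tau> \<in> J" using p py by auto
    have "dist \<tau> t < d1" "dist y x < d2"
      using p dist_fst_le[of p "(t, x)"] dist_snd_le[of p "(t, x)"] py by auto
    have "\<bar>u \<tau> y - u t y\<bar> < e/2"
    proof (cases "\<tau> = t")
      case False
      then show ?thesis using d1(2)[OF \<tau> False \<open>dist \<tau> t < d1\<close>] le[OF t \<tau>, of y] by linarith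
    qed (use e in auto)
    moreover have "\<bar>u t y - u t x\<bar> < e/2" using d2(2)[OF \<open>dist y x < d2\<close>] by (simp add: dist_real_def)
    ultimately show "dist (u (fst p) (snd p)) (u (fst (t, x)) (snd (t, x))) < e"
      unfolding py dist_real_def fst_conv snd_conv by linarith
  qed (use d1 d2 in auto)
qed

lemma uniform_limit_mult_compact:
  fixes f g :: "nat \<Rightarrow> 'a::topological_space \<Rightarrow> real"
  assumes "uniform_limit K f l F" "uniform_limit K g m F"
    and "compact K" "continuous_on K l" "continuous_on K m"
  shows "uniform_limit K (\<lambda>n x. f n x * g n x) (\<lambda>x. l x * m x) F"
  using assms by (intro uniform_lim_mult compact_imp_bounded compact_continuous_image)

lemma uniform_limit_power_compact:
  fixes f :: "nat \<Rightarrow> 'a::topological_space \<Rightarrow> real"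
  assumes "uniform_limit K f l F" "compact K" "continuous_on K l"
  shows "uniform_limit K (\<lambda>n x. f n x ^ k) (\<lambda>x. l x ^ k) F"
proof (induction k)
  case 0
  show ?case by (simp add: uniform_limit_const)
next
  case (Suc k)
  then show ?case using assms
    by (auto intro!: uniform_limit_mult_compact continuous_intros)
qed

lemma uniform_limit_integral_second:
  fixes F :: "nat \<Rightarrow> real \<times> real \<Rightarrow> real"
  assumes lim: "uniform_limit (J \<times> {0..1}) F L sequentially"
    and c: "\<And>n. continuous_on (J \<times> {0..1}) (F n)" and cL: "continuous_on (J \<times> {0..1}) L"
  shows "uniform_limit J (\<lambda>n t. integral {0..1} (\<lambda>x. F n (t, x))) (\<lambda>t. integral {0..1} (\<lambda>x. L (t, x))) sequentially"
proof (rule uniform_limitI)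
  fix e :: real assume e: "e > 0"
  have "\<forall>\<^sub>F n in sequentially. \<forall>p\<in>J \<times> {0..1}. dist (F n p) (L p) < e/2"
    using uniform_limitD[OF lim, of "e/2"] e by simp
  then show "\<forall>\<^sub>F n in sequentially. \<forall>t\<in>J. dist (integral {0..1} (\<lambda>x. F n (t, x))) (integral {0..1} (\<lambda>x. L (t, x))) < e"
  proof (rule eventually_mono, intro ballI)
    fix n t assume n: "\<forall>p\<in>J \<times> {0..1}. dist (F n p) (L p) < e/2" and t: "t \<in> J"
    have cc: "continuous_on {0..1} (\<lambda>x. F n (t, x))" "continuous_on {0..1} (\<lambda>x. L (t, x))"
      using t by (auto intro!: continuous_on_compose2[OF c] continuous_on_compose2[OF cL] continuous_intros)
    have "norm (integral {0..1} (\<lambda>x. F n (t, x) - L (t, x))) \<le> integral {0..1} (\<lambda>x::real. e/2)"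
      by (rule integral_norm_bound_integral)
         (use n t cc in \<open>auto intro!: integrable_continuous_real continuous_intros less_imp_le simp: dist_real_def\<close>)
    also have "\<dots> < e" using e by simp
    finally show "dist (integral {0..1} (\<lambda>x. F n (t, x))) (integral {0..1} (\<lambda>x. L (t, x))) < e"
      using cc by (subst (asm) integral_diff) (auto intro!: integrable_continuous_real simp: dist_real_def)
  qed
qed

lemma has_derivative_uniform_limit:
  fixes f :: "nat \<Rightarrow> real \<Rightarrow> real"
  assumes J: "convex J" and t: "t \<in> J"
    and f: "\<And>n t. t \<in> J \<Longrightarrow> (f n has_real_derivative f' n t) (at t within J)"
    and lim': "uniform_limit J f' g' sequentially"
    and lim: "\<And>t. t \<in> J \<Longrightarrow> (\<lambda>n. f n t) \<longlonglongrightarrow> g t"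
  shows "(g has_real_derivative g' t) (at t within J)"
proof -
  have "\<exists>G. \<forall>x\<in>J. (\<lambda>n. f n x) \<longlonglongrightarrow> G x \<and> (G has_derivative (*) (g' x)) (at x within J)"
  proof (rule has_derivative_sequence[where f = f and f' = "\<lambda>n x. (*) (f' n x)"
        and g' = "\<lambda>x. (*) (g' x)" and l = "g t", OF J])
    show "t \<in> J" by (rule t)
    show "(\<lambda>n. f n t) \<longlonglongrightarrow> g t" by (rule lim[OF t])
    show "(f n has_derivative (*) (f' n x)) (at x within J)" if "x \<in> J" for n x
      using f[OF that] by (simp add: has_field_derivative_def)
    fix e :: real assume "e > 0"
    from uniform_limitD[OF lim' this]
    show "\<forall>\<^sub>F n in sequentially. \<forall>x\<in>J. \<forall>h. norm (f' n x * h - g' x * h) \<le> e * norm h"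
    proof (rule eventually_mono, intro ballI allI)
      fix n x h assume "\<forall>x\<in>J. dist (f' n x) (g' x) < e" "x \<in> J"
      then have "\<bar>f' n x - g' x\<bar> \<le> e" by (auto simp: dist_real_def less_imp_le)
      then have "\<bar>f' n x - g' x\<bar> * \<bar>h\<bar> \<le> e * \<bar>h\<bar>" by (intro mult_right_mono) auto
      then show "norm (f' n x * h - g' x * h) \<le> e * norm h"
        by (simp add: abs_mult left_diff_distrib flip: abs_mult)
    qed
  qed
  then obtain G where G: "\<And>x. x \<in> J \<Longrightarrow> (\<lambda>n. f n x) \<longlonglongrightarrow> G x"
    "\<And>x. x \<in> J \<Longrightarrow> (G has_real_derivative g' x) (at x within J)"
    by (auto simp: has_field_derivative_def)
  have "G x = g x" if "x \<in> J" for x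
    using LIMSEQ_unique[OF G(1) lim] that by blast
  with G(2)[OF t] t show ?thesis
    by (intro has_field_derivative_transform_within[of G _ _ _ 1 g]) auto
qed

lemma joint_continuous_shift:
  fixes \<phi> :: "real \<Rightarrow> real \<Rightarrow> real"
  assumes "continuous_on (J \<times> UNIV) (\<lambda>p. \<phi> (fst p) (snd p))"
  shows "continuous_on (J \<times> S) (\<lambda>p. \<phi> (fst p) (snd p + c))"
proof -
  have "continuous_on (J \<times> S) (\<lambda>p. (fst p, snd p + c))" by (intro continuous_intros)
  moreover have "(\<lambda>p. (fst p, snd p + c)) ` (J \<times> S) \<subseteq> J \<times> UNIV" by auto
  ultimately show ?thesis using continuous_on_compose2[OF assms] by fastforce
qed

lemma joint_continuous_section:
  fixes \<phi> :: "real \<Rightarrow> real \<Rightarrow> real"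
  assumes "continuous_on (J \<times> UNIV) (\<lambda>p. \<phi> (fst p) (snd p))" "t \<in> J"
  shows "continuous_on S (\<phi> t)"
proof -
  have "continuous_on S (\<lambda>x. (t, x))" by (intro continuous_intros)
  from continuous_on_compose2[OF assms(1) this] assms(2) show ?thesis by auto
qed

text \<open>
  Difference quotients in \<open>x\<close> are taken along the step sizes \<open>h n\<close>, on a compact time interval
  \<open>J\<close>. The space variable ranges over one period, but the shifted points leave it by up to \<open>h
  n \<le> 1\<close>.
\<close>

context
  fixes a :: real and J :: "real set" and h :: "nat \<Rightarrow> real"
  defines "J \<equiv> {0..a}" and "h \<equiv> \<lambda>n. inverse (real (Suc n))"
begin

lemma step_size: "h n > 0" "h n \<le> 1" "h \<longlonglongrightarrow> 0"
  unfolding h_def using LIMSEQ_inverse_real_of_nat by (auto simp: field_simps)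

text \<open>
  Both the shifts and, by the mean value theorem, the difference quotients have the form
  considered here; the convergence is uniform continuity on a compact rectangle.
\<close>

lemma uniform_limit_near:
  fixes \<phi> :: "real \<Rightarrow> real \<Rightarrow> real"
  assumes \<phi>: "continuous_on (J \<times> UNIV) (\<lambda>p. \<phi> (fst p) (snd p))"
    and near: "\<And>n t x. t \<in> J \<Longrightarrow> x \<in> {0..1} \<Longrightarrow> \<exists>y\<in>{x..x + h n}. F n (t, x) = \<phi> t y"
  shows "uniform_limit (J \<times> {0..1}) F (\<lambda>p. \<phi> (fst p) (snd p)) sequentially"
proof (rule uniform_limitI)
  fix e :: real assume e: "e > 0"
  have "continuous_on (J \<times> {0..2}) (\<lambda>p. \<phi> (fst p) (snd p))"
    using \<phi> by (rule continuous_on_subset) auto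
  then have "uniformly_continuous_on (J \<times> {0..2}) (\<lambda>p. \<phi> (fst p) (snd p))"
    by (rule compact_uniformly_continuous) (auto simp: J_def compact_Times)
  from uniformly_continuous_onE[OF this e]
  obtain d where d: "d > 0" "\<And>p q. p \<in> J \<times> {0..2} \<Longrightarrow> q \<in> J \<times> {0..2} \<Longrightarrow> dist q p < d \<Longrightarrow>
      dist (\<phi> (fst q) (snd q)) (\<phi> (fst p) (snd p)) < e" by metis
  have "\<forall>\<^sub>F n in sequentially. h n < d" using order_tendstoD(2)[OF step_size(3) d(1)] .
  then show "\<forall>\<^sub>F n in sequentially. \<forall>p\<in>J \<times> {0..1}. dist (F n p) (\<phi> (fst p) (snd p)) < e"
  proof (rule eventually_mono, clarify)
    fix n t x assume n: "h n < d" and t: "t \<in> J" and x: "x \<in> {0..(1::real)}"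
    obtain y where y: "y \<in> {x..x + h n}" "F n (t, x) = \<phi> t y" using near[OF t x] by blast
    have "dist (\<phi> (fst (t, y)) (snd (t, y))) (\<phi> (fst (t, x)) (snd (t, x))) < e"
    proof (rule d(2))
      show "dist (t, y) (t, x) < d" using y n by (simp add: dist_Pair_Pair dist_real_def)
    qed (use t x y step_size(2)[of n] in auto)
    then show "dist (F n (t, x)) (\<phi> (fst (t, x)) (snd (t, x))) < e" using y by simp
  qed
qed

lemma uniform_limit_difference_quotient:
  assumes \<phi>x: "continuous_on (J \<times> UNIV) (\<lambda>p. \<phi>x (fst p) (snd p))"
    and D: "\<And>t x. t \<in> J \<Longrightarrow> (\<phi> t has_real_derivative \<phi>x t x) (at x)"
  shows "uniform_limit (J \<times> {0..1}) (\<lambda>n p. (\<phi> (fst p) (snd p + h n) - \<phi> (fst p) (snd p)) / h n)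
     (\<lambda>p. \<phi>x (fst p) (snd p)) sequentially"
proof (rule uniform_limit_near[OF \<phi>x])
  fix n t x assume t: "t \<in> J" and x: "x \<in> {0..(1::real)}"
  have "\<exists>z>x. z < x + h n \<and> \<phi> t (x + h n) - \<phi> t x = (x + h n - x) * \<phi>x t z"
    by (rule MVT2) (use step_size(1)[of n] D[OF t] in auto)
  then obtain z where "x < z" "z < x + h n" "\<phi> t (x + h n) - \<phi> t x = h n * \<phi>x t z" by auto
  then show "\<exists>y\<in>{x..x + h n}. (\<phi> (fst (t, x)) (snd (t, x) + h n) - \<phi> (fst (t, x)) (snd (t, x))) / h n = \<phi>x t y"
    using step_size(1)[of n] by (intro bexI[of _ z]) (auto simp: field_simps)
qed

text \<open>
  For \<open>u\<^sub>t = - u u\<^sub>x + G\<close> the formal computation is \<open>d/dt \<integral>u\<^sub>x\<^bsup>k+1\<^esup> = (k+1) \<integral>u\<^sub>x\<^sup>k (- u\<^sub>x\<^sup>2 -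
  u u\<^sub>x\<^sub>x + G\<^sub>x)\<close>, where integrating by parts turns the term with \<open>u\<^sub>x\<^sub>x\<close> into a multiple of
  \<open>\<integral>u\<^sub>x\<^bsup>k+2\<^esup>\<close>. Since \<open>u\<^sub>x\<^sub>x\<close> and \<open>u\<^sub>t\<^sub>x\<close> are in general only distributions, the computation is
  done with the difference quotient \<open>D u\<close> in place of \<open>u\<^sub>x\<close>. There it is exact because of the
  product rule \<open>2 D (u u\<^sub>x) = (S u) (D u\<^sub>x) + (S u\<^sub>x) (D u)\<close> with \<open>S \<phi> x = \<phi> (x + h) + \<phi> x\<close>:
  both factors \<open>D u\<^sub>x\<close> and \<open>S u\<^sub>x\<close> are the \<open>x\<close>-derivatives of \<open>D u\<close> and \<open>S u\<close>. Then \<open>h\<close> tends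
  to \<open>0\<close>.
\<close>

theorem moment_derivative:
  fixes u ux v G Gx :: "real \<Rightarrow> real \<Rightarrow> real" and k :: nat
  assumes cu: "continuous_on (J \<times> UNIV) (\<lambda>p. u (fst p) (snd p))"
    and cux: "continuous_on (J \<times> UNIV) (\<lambda>p. ux (fst p) (snd p))"
    and cv: "continuous_on (J \<times> UNIV) (\<lambda>p. v (fst p) (snd p))"
    and cGx: "continuous_on (J \<times> UNIV) (\<lambda>p. Gx (fst p) (snd p))"
    and u_per: "\<And>t x. t \<in> J \<Longrightarrow> u t (x + 1) = u t x"
    and u_x: "\<And>t x. t \<in> J \<Longrightarrow> (u t has_real_derivative ux t x) (at x)"
    and G_x: "\<And>t x. t \<in> J \<Longrightarrow> (G t has_real_derivative Gx t x) (at x)"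
    and u_t: "\<And>t x. t \<in> J \<Longrightarrow> ((\<lambda>\<tau>. u \<tau> x) has_real_derivative v t x) (at t within J)"
    and eq: "\<And>t x. t \<in> J \<Longrightarrow> v t x = - u t x * ux t x + G t x"
    and t: "t \<in> J"
  shows "((\<lambda>t. integral {0..1} (\<lambda>x. ux t x ^ Suc k)) has_real_derivative
     - real k * integral {0..1} (\<lambda>x. ux t x ^ (k + 2))
     + real (Suc k) * integral {0..1} (\<lambda>x. ux t x ^ k * Gx t x)) (at t within J)"
proof -
  define D where "D n \<phi> t x = (\<phi> t (x + h n) - \<phi> t x) / h n" for n and \<phi> :: "real \<Rightarrow> real \<Rightarrow> real" and t x
  have h0: "h n \<noteq> 0" for n using step_size(1)[of n] by simp
  have cG: "continuous_on (J \<times> UNIV) (\<lambda>p. G (fst p) (snd p))"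
  proof -
    have "continuous_on (J \<times> UNIV) (\<lambda>p. v (fst p) (snd p) + u (fst p) (snd p) * ux (fst p) (snd p))"
      by (intro continuous_intros cu cux cv)
    then show ?thesis by (rule continuous_on_eq) (use eq in auto)
  qed
  have cD: "continuous_on (J \<times> S) (\<lambda>p. D n \<phi> (fst p) (snd p))"
    if "continuous_on (J \<times> UNIV) (\<lambda>p. \<phi> (fst p) (snd p))" for n \<phi> S
    unfolding D_def using joint_continuous_shift[OF that, of S 0] joint_continuous_shift[OF that, of S "h n"] h0
    by (auto intro!: continuous_intros)
  have cS: "continuous_on (J \<times> S) (\<lambda>p. \<phi> (fst p) (snd p))"
    if "continuous_on (J \<times> UNIV) (\<lambda>p. \<phi> (fst p) (snd p))" for \<phi> :: "real \<Rightarrow> real \<Rightarrow> real" and S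
    using joint_continuous_shift[OF that, of S 0] by simp
  have sec: "continuous_on S (\<lambda>x. \<phi> t (x + c))" "continuous_on S (D n \<phi> t)"
    if "continuous_on (J \<times> UNIV) (\<lambda>p. \<phi> (fst p) (snd p))" "t \<in> J" for n \<phi> S t c
  proof -
    show *: "continuous_on S (\<lambda>x. \<phi> t (x + c))" for c
      by (rule continuous_on_compose2[OF joint_continuous_section[OF that]]) (auto intro!: continuous_intros)
    show "continuous_on S (D n \<phi> t)"
      unfolding D_def [abs_def] using *[of "h n"] *[of 0] h0 by (auto intro!: continuous_intros)
  qed
  define f where "f n t = integral {0..1} (\<lambda>x. D n u t x ^ Suc k)" for n t
  define f' where "f' n t = integral {0..1} (\<lambda>x. - (real k / 2) * (ux t (x + h n) + ux t x) * D n u t x ^ Suc k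
      + real (Suc k) * D n u t x ^ k * D n G t x)" for n t
  define g where "g t = integral {0..1} (\<lambda>x. ux t x ^ Suc k)" for t
  define g' where "g' t = integral {0..1} (\<lambda>x. - (real k / 2) * (ux t x + ux t x) * ux t x ^ Suc k
      + real (Suc k) * ux t x ^ k * Gx t x)" for t
  have f: "(f n has_real_derivative f' n t) (at t within J)" if t: "t \<in> J" for n t
  proof -
    have "((\<lambda>\<tau>. integral (cbox 0 1) (\<lambda>x. D n u \<tau> x ^ Suc k)) has_field_derivative
        integral (cbox 0 1) (\<lambda>x. real (Suc k) * D n u t x ^ k * D n v t x)) (at t within J)"
    proof (rule leibniz_rule_field_derivative)
      show "((\<lambda>\<tau>. D n u \<tau> x ^ Suc k) has_real_derivative real (Suc k) * D n u t x ^ k * D n v t x) (at t within J)"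
        if "t \<in> J" for t x
      proof -
        have "((\<lambda>\<tau>. D n u \<tau> x) has_real_derivative D n v t x) (at t within J)"
          unfolding D_def by (intro DERIV_cdivide DERIV_diff u_t that)
        from DERIV_power[OF this, of "Suc k"] show ?thesis by (simp add: mult_ac)
      qed
      show "(\<lambda>x. D n u t x ^ Suc k) integrable_on cbox 0 1" if "t \<in> J" for t
        using sec(2)[OF cu that] by (auto intro!: integrable_continuous_real continuous_intros)
      show "continuous_on (J \<times> cbox 0 1) (\<lambda>(t, x). real (Suc k) * D n u t x ^ k * D n v t x)"
        unfolding split_beta by (intro continuous_intros cD cu cv)
      show "t \<in> J" "convex J" using t by (auto simp: J_def)
    qed
    moreover have "integral {0..1} (\<lambda>x. real (Suc k) * D n u t x ^ k * D n v t x) = f' n t"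
    proof -
      \<comment> \<open>\<open>P\<close> is the derivative of the periodic function \<open>(S u) (D u)\<^bsup>k+1\<^esup>\<close>, so its integral vanishes.\<close>
      define P where "P x = (ux t (x + h n) + ux t x) * D n u t x ^ Suc k
         + (u t (x + h n) + u t x) * (real (Suc k) * D n u t x ^ k * D n ux t x)" for x
      have shift: "((\<lambda>x. u t (x + h n)) has_real_derivative ux t (x + h n)) (at x)" for x
        using u_x[OF t, of "x + h n"] by (simp add: DERIV_shift)
      have "((\<lambda>x. (u t (x + h n) + u t x) * D n u t x ^ Suc k) has_real_derivative P x) (at x)" for x
      proof -
        have "((\<lambda>x. D n u t x) has_real_derivative D n ux t x) (at x)"
          unfolding D_def by (intro DERIV_cdivide DERIV_diff u_x t shift)
        from DERIV_power[OF this, of "Suc k"]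
        have "((\<lambda>x. D n u t x ^ Suc k) has_real_derivative real (Suc k) * D n u t x ^ k * D n ux t x) (at x)"
          by (simp add: mult_ac)
        from DERIV_mult[OF DERIV_add[OF shift u_x[OF t]] this] show ?thesis
          by (simp add: P_def algebra_simps)
      qed
      note P = FTC_unit[OF this]
      have "D n u t 1 = D n u t 0" "u t (1 + h n) = u t (0 + h n)" "u t 1 = u t 0"
        using u_per[OF t, of "h n"] u_per[OF t, of 0] by (auto simp: D_def add.commute)
      with P have P0: "(P has_integral 0) {0..1}" by simp
      have pw: "real (Suc k) * D n u t x ^ k * D n v t x = (- (real k / 2) * (ux t (x + h n) + ux t x) * D n u t x ^ Suc k
          + real (Suc k) * D n u t x ^ k * D n G t x) - P x / 2" for x
      proof -
        have Dv: "D n v t x = - (1/2) * ((ux t (x + h n) + ux t x) * D n u t x + (u t (x + h n) + u t x) * D n ux t x) + D n G t x"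
          using h0[of n] by (simp add: D_def eq[OF t] field_simps)
        show ?thesis unfolding Dv P_def by (simp add: field_simps)
      qed
      have "((\<lambda>x. - (real k / 2) * (ux t (x + h n) + ux t x) * D n u t x ^ Suc k
      + real (Suc k) * D n u t x ^ k * D n G t x) has_integral f' n t) {0..1}"
        unfolding f'_def using sec[OF cux t] sec(1)[OF cux t, of _ 0] sec[OF cu t] sec[OF cG t]
        by (intro integrable_integral integrable_continuous_real) (auto intro!: continuous_intros)
      from has_integral_diff[OF this has_integral_divide[OF P0, of 2]] show ?thesis
        unfolding pw by (simp add: integral_unique)
    qed
    ultimately show ?thesis by (simp add: f_def [abs_def])
  qed
  have K: "compact (J \<times> {0..(1::real)})" by (auto simp: J_def compact_Times)
  have lim_Du: "uniform_limit (J \<times> {0..1}) (\<lambda>n p. D n u (fst p) (snd p)) (\<lambda>p. ux (fst p) (snd p)) sequentially"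
    unfolding D_def by (rule uniform_limit_difference_quotient[OF cux u_x])
  have lim_DG: "uniform_limit (J \<times> {0..1}) (\<lambda>n p. D n G (fst p) (snd p)) (\<lambda>p. Gx (fst p) (snd p)) sequentially"
    unfolding D_def by (rule uniform_limit_difference_quotient[OF cGx G_x])
  have lim_S: "uniform_limit (J \<times> {0..1}) (\<lambda>n p. ux (fst p) (snd p + h n)) (\<lambda>p. ux (fst p) (snd p)) sequentially"
    by (rule uniform_limit_near[OF cux]) (use step_size(1) less_imp_le in fastforce)
  have "uniform_limit J f' g' sequentially"
  proof -
    have c: "continuous_on (J \<times> {0..1}) (\<lambda>p. ux (fst p) (snd p))"
        "continuous_on (J \<times> {0..1}) (\<lambda>p. Gx (fst p) (snd p))"
      using cS[OF cux] cS[OF cGx] by auto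
    note pow = uniform_limit_power_compact[OF lim_Du K c(1)]
    have 1: "uniform_limit (J \<times> {0..1}) (\<lambda>n p. - (real k / 2) * (ux (fst p) (snd p + h n) + ux (fst p) (snd p)))
        (\<lambda>p. - (real k / 2) * (ux (fst p) (snd p) + ux (fst p) (snd p))) sequentially"
      by (rule uniform_limit_mult_compact[OF uniform_limit_const uniform_limit_add[OF lim_S uniform_limit_const] K])
         (intro continuous_intros c)+
    have 2: "uniform_limit (J \<times> {0..1}) (\<lambda>n p. - (real k / 2) * (ux (fst p) (snd p + h n) + ux (fst p) (snd p)) * D n u (fst p) (snd p) ^ Suc k)
        (\<lambda>p. - (real k / 2) * (ux (fst p) (snd p) + ux (fst p) (snd p)) * ux (fst p) (snd p) ^ Suc k) sequentially"
      by (rule uniform_limit_mult_compact[OF 1 pow K]) (intro continuous_intros c)+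
    have 3: "uniform_limit (J \<times> {0..1}) (\<lambda>n p. real (Suc k) * D n u (fst p) (snd p) ^ k)
        (\<lambda>p. real (Suc k) * ux (fst p) (snd p) ^ k) sequentially"
      by (rule uniform_limit_mult_compact[OF uniform_limit_const pow K]) (intro continuous_intros c)+
    have 4: "uniform_limit (J \<times> {0..1}) (\<lambda>n p. real (Suc k) * D n u (fst p) (snd p) ^ k * D n G (fst p) (snd p))
        (\<lambda>p. real (Suc k) * ux (fst p) (snd p) ^ k * Gx (fst p) (snd p)) sequentially"
      by (rule uniform_limit_mult_compact[OF 3 lim_DG K]) (intro continuous_intros c)+
    have "uniform_limit J (\<lambda>n t. integral {0..1} (\<lambda>x. (\<lambda>p. - (real k / 2) * (ux (fst p) (snd p + h n) + ux (fst p) (snd p)) * D n u (fst p) (snd p) ^ Suc k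
      + real (Suc k) * D n u (fst p) (snd p) ^ k * D n G (fst p) (snd p)) (t, x)))
      (\<lambda>t. integral {0..1} (\<lambda>x. (\<lambda>p. - (real k / 2) * (ux (fst p) (snd p) + ux (fst p) (snd p)) * ux (fst p) (snd p) ^ Suc k
      + real (Suc k) * ux (fst p) (snd p) ^ k * Gx (fst p) (snd p)) (t, x))) sequentially"
    proof (rule uniform_limit_integral_second[OF uniform_limit_add[OF 2 4]])
      show "continuous_on (J \<times> {0..1}) (\<lambda>p. - (real k / 2) * (ux (fst p) (snd p + h n) + ux (fst p) (snd p)) * D n u (fst p) (snd p) ^ Suc k
          + real (Suc k) * D n u (fst p) (snd p) ^ k * D n G (fst p) (snd p))" for n
        using joint_continuous_shift[OF cux, of "{0..1}" "h n"] cD[OF cu, of "{0..1}" n] cD[OF cG, of "{0..1}" n] c(1)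
        by (intro continuous_intros)
      show "continuous_on (J \<times> {0..1}) (\<lambda>p. - (real k / 2) * (ux (fst p) (snd p) + ux (fst p) (snd p)) * ux (fst p) (snd p) ^ Suc k
          + real (Suc k) * ux (fst p) (snd p) ^ k * Gx (fst p) (snd p))"
        using c by (intro continuous_intros)
    qed
    then show ?thesis by (simp add: f'_def [abs_def] g'_def [abs_def])
  qed
  moreover have "(\<lambda>n. f n t) \<longlonglongrightarrow> g t" if "t \<in> J" for t
  proof -
    have "uniform_limit J (\<lambda>n t. integral {0..1} (\<lambda>x. (\<lambda>p. D n u (fst p) (snd p) ^ Suc k) (t, x)))
      (\<lambda>t. integral {0..1} (\<lambda>x. (\<lambda>p. ux (fst p) (snd p) ^ Suc k) (t, x))) sequentially"
      using cD[OF cu, of "{0..1}"] cS[OF cux, of "{0..1}"]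
      by (intro uniform_limit_integral_second uniform_limit_power_compact[OF lim_Du K])
         (rule continuous_on_power, assumption | assumption)+
    from tendsto_uniform_limitI[OF this that] show ?thesis by (simp add: f_def g_def)
  qed
  ultimately have "(g has_real_derivative g' t) (at t within J)"
    by (intro has_derivative_uniform_limit[OF _ t f]) (auto simp: J_def)
  moreover have "g' t = - real k * integral {0..1} (\<lambda>x. ux t x ^ (k + 2))
     + real (Suc k) * integral {0..1} (\<lambda>x. ux t x ^ k * Gx t x)"
  proof -
    have "((\<lambda>x. - real k * ux t x ^ (k + 2) + real (Suc k) * (ux t x ^ k * Gx t x)) has_integral
     - real k * integral {0..1} (\<lambda>x. ux t x ^ (k + 2)) + real (Suc k) * integral {0..1} (\<lambda>x. ux t x ^ k * Gx t x)) {0..1}"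
      by (intro has_integral_add has_integral_mult_right integrable_integral integrable_continuous_real
          continuous_intros joint_continuous_section[OF cux t] joint_continuous_section[OF cGx t])
    then show ?thesis unfolding g'_def
      by (intro integral_unique) (simp add: algebra_simps)
  qed
  ultimately show ?thesis by (simp add: g_def [abs_def])
qed

end

section \<open>A Riccati differential inequality\<close>

lemma increasing_within:
  fixes f :: "real \<Rightarrow> real"
  assumes f: "\<And>t. t \<in> {0..a} \<Longrightarrow> (f has_real_derivative f' t) (at t within {0..a})"
    and f': "\<And>t. t \<in> {0..a} \<Longrightarrow> f' t \<ge> 0" and t: "t \<in> {0..a}"
  shows "f 0 \<le> f t"
proof (rule DERIV_nonneg_imp_increasing_open[of 0 t f])
  show "continuous_on {0..t} f"
    using DERIV_continuous_on[OF f] by (rule continuous_on_subset) (use t in auto)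
  show "\<exists>y. (f has_real_derivative y) (at x) \<and> 0 \<le> y" if "0 < x" "x < t" for x
    using f[of x] f'[of x] that t by (auto simp: at_within_Icc_at)
qed (use t in auto)

lemma linear_decay:
  fixes f :: "real \<Rightarrow> real"
  assumes f: "\<And>t. t \<in> {0..a} \<Longrightarrow> (f has_real_derivative - c * f t) (at t within {0..a})"
    and t: "t \<in> {0..a}"
  shows "f t = f 0 * exp (- c * t)"
proof -
  have "((\<lambda>t. f t * exp (c * t)) has_real_derivative 0) (at t within {0..a})" if "t \<in> {0..a}" for t
    using f[OF that] by (auto intro!: derivative_eq_intros)
  then obtain d where "\<And>t. t \<in> {0..a} \<Longrightarrow> f t * exp (c * t) = d"
    using has_field_derivative_zero_constant[of "{0..a}" "\<lambda>t. f t * exp (c * t)"] by auto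
  then have "f t * exp (c * t) = f 0 * exp (c * 0)" using t by (metis atLeastAtMost_iff order.trans order_refl)
  then show ?thesis by (simp add: exp_minus field_simps)
qed

text \<open>
  \<open>r\<close> is the smaller root of the quadratic \<open>- V\<^sup>2 / (2 m) - 3 lam V + K\<close>, and \<open>r + 2 d\<close> is the
  larger one. The distance \<open>W = r - V\<close> satisfies \<open>W' \<ge> (W + 2 d) W / (2 m)\<close>. An integrating
  factor shows that \<open>W\<close> stays positive, whence \<open>W' \<ge> W\<^sup>2 / (2 m)\<close>; so \<open>1 / W\<close> decreases at
  least at the rate \<open>1 / (2 m)\<close> and would reach \<open>0\<close> by the stated time.
\<close>

theorem riccati_lifespan:
  fixes V V' :: "real \<Rightarrow> real"
  assumes V: "\<And>t. t \<in> {0..a} \<Longrightarrow> (V has_real_derivative V' t) (at t within {0..a})"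
    and le: "\<And>t. t \<in> {0..a} \<Longrightarrow> V' t \<le> - (V t)\<^sup>2 / (2 * m) - 3 * lam * V t + K"
    and m: "m > 0" and K: "K \<ge> 0" and a: "a \<ge> 0"
    and r: "r = - 3 * lam * m - sqrt (9 * lam\<^sup>2 * m\<^sup>2 + 2 * K * m)"
    and V0: "V 0 < r"
  shows "a < 2 * m / (r - V 0)"
proof -
  define d where "d = sqrt (9 * lam\<^sup>2 * m\<^sup>2 + 2 * K * m)"
  have d0: "d \<ge> 0" unfolding d_def using m K by simp
  have d2: "d\<^sup>2 = 9 * lam\<^sup>2 * m\<^sup>2 + 2 * K * m" unfolding d_def using m K by simp
  define W where "W t = r - V t" for t
  define c where "c t = (W t + 2 * d) / (2 * m)" for t
  have W: "(W has_real_derivative - V' t) (at t within {0..a})" if "t \<in> {0..a}" for t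
    unfolding W_def using V[OF that] by (auto intro!: derivative_eq_intros)
  have W': "- V' t \<ge> c t * W t" if "t \<in> {0..a}" for t
  proof -
    have "c t * W t = ((V t)\<^sup>2 + 6 * lam * m * V t + 9 * lam\<^sup>2 * m\<^sup>2 - d\<^sup>2) / (2 * m)"
      unfolding c_def W_def r d_def [symmetric] by (simp add: power2_eq_square algebra_simps)
    also have "\<dots> = (V t)\<^sup>2 / (2 * m) + 3 * lam * V t - K"
      unfolding d2 using m by (simp add: field_simps power2_eq_square)
    finally show ?thesis using le[OF that] by simp
  qed
  have Wc: "continuous_on {0..a} W" using W by (rule DERIV_continuous_on)
  define C where "C t = integral {0..t} c" for t
  have cc: "continuous_on {0..a} c" unfolding c_def using m by (intro continuous_intros Wc) auto
  have C: "(C has_real_derivative c t) (at t within {0..a})" if "t \<in> {0..a}" for t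
    unfolding C_def by (rule integral_has_real_derivative[OF cc that])
  have W0: "W 0 > 0" using V0 by (simp add: W_def)
  have Wpos: "W t > 0" if t: "t \<in> {0..a}" for t
  proof -
    have "W 0 * exp (- C 0) \<le> W t * exp (- C t)"
    proof (rule increasing_within[where f' = "\<lambda>t. (- V' t - c t * W t) * exp (- C t)" and a = a])
      show "((\<lambda>t. W t * exp (- C t)) has_real_derivative (- V' t - c t * W t) * exp (- C t)) (at t within {0..a})"
        if "t \<in> {0..a}" for t
        using W[OF that] C[OF that] by (auto intro!: derivative_eq_intros simp: algebra_simps)
    qed (use W' t in auto)
    then have "0 < W t * exp (- C t)" using W0 by (smt (verit) exp_gt_zero mult_pos_pos)
    then show ?thesis by (simp add: zero_less_mult_iff)
  qed
  have "- inverse (W 0) - 0 / (2 * m) \<le> - inverse (W a) - a / (2 * m)"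
  proof (rule increasing_within[where f' = "\<lambda>t. - V' t / (W t)\<^sup>2 - 1 / (2 * m)" and a = a])
    fix t assume t: "t \<in> {0..a}"
    show "((\<lambda>t. - inverse (W t) - t / (2 * m)) has_real_derivative - V' t / (W t)\<^sup>2 - 1 / (2 * m)) (at t within {0..a})"
      using W[OF t] Wpos[OF t] m
      by (auto intro!: derivative_eq_intros simp: power2_eq_square field_simps)
    have "(W t)\<^sup>2 / (2 * m) \<le> c t * W t"
      using Wpos[OF t] d0 m by (simp add: c_def power2_eq_square divide_right_mono algebra_simps)
    also note W'[OF t]
    finally show "0 \<le> - V' t / (W t)\<^sup>2 - 1 / (2 * m)"
      using Wpos[OF t] m by (simp add: field_simps)
  qed (use a in auto)
  then have "a / (2 * m) < inverse (W 0)" using Wpos[of a] a by (smt (verit) atLeastAtMost_iff positive_imp_inverse_positive divide_eq_0_iff)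
  then show ?thesis using W0 m by (simp add: W_def field_simps)
qed

section \<open>Energy and third moment of a solution\<close>

text \<open>
  What the analysis needs to know about a solution on the compact interval \<open>[0,a]\<close>: \<open>ux\<close> and
  \<open>v\<close> are the space and time derivatives of \<open>u\<close>, and \<open>q\<close> is the nonlocal term \<open>\<partial>\<^sub>x A\<^bsup>-1\<^esup> f\<close>.
  The latter enters only through \<open>q\<^sub>x = mean f - f\<close> and its vanishing mean.
\<close>

locale muHS_classical =
  fixes lam a m0 :: real and u ux v q :: "real \<Rightarrow> real \<Rightarrow> real" and f :: "real \<Rightarrow> real \<Rightarrow> real"
    and J :: "real set"
  assumes lam: "lam > 0" and J_def: "J = {0..a}" and a0: "a \<ge> 0"
    and cu: "continuous_on (J \<times> UNIV) (\<lambda>p. u (fst p) (snd p))"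
    and cux: "continuous_on (J \<times> UNIV) (\<lambda>p. ux (fst p) (snd p))"
    and cv: "continuous_on (J \<times> UNIV) (\<lambda>p. v (fst p) (snd p))"
    and u_per: "\<And>t x. t \<in> J \<Longrightarrow> u t (x + 1) = u t x"
    and ux_per: "\<And>t x. t \<in> J \<Longrightarrow> ux t (x + 1) = ux t x"
    and u_x: "\<And>t x. t \<in> J \<Longrightarrow> (u t has_real_derivative ux t x) (at x)"
    and u_t: "\<And>t x. t \<in> J \<Longrightarrow> ((\<lambda>\<tau>. u \<tau> x) has_real_derivative v t x) (at t within J)"
    and f_def: "f = (\<lambda>t x. 2 * m0 * exp (- lam * t) * u t x + (ux t x)\<^sup>2 / 2)"
    and q_x: "\<And>t x. t \<in> J \<Longrightarrow> (q t has_real_derivative mean (f t) - f t x) (at x)"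
    and q_mean: "\<And>t. t \<in> J \<Longrightarrow> integral {0..1} (q t) = 0"
    and eq: "\<And>t x. t \<in> J \<Longrightarrow> v t x = - u t x * ux t x - q t x - lam * u t x"
    and m0: "m0 = mean (u 0)"
begin

definition E where "E t = integral {0..1} (\<lambda>x. (ux t x)\<^sup>2)"
definition V where "V t = integral {0..1} (\<lambda>x. ux t x ^ 3)"
definition Q where "Q t = integral {0..1} (\<lambda>x. ux t x ^ 4)"

lemma zero_in_J: "0 \<in> J"
  using a0 by (simp add: J_def)

lemma sections [continuous_intros]:
  assumes "t \<in> J"
  shows "continuous_on S (u t)" "continuous_on S (ux t)" "continuous_on S (v t)" "continuous_on S (q t)"
  using joint_continuous_section[OF cu] joint_continuous_section[OF cux]
    joint_continuous_section[OF cv] continuous_on_DERIV[OF q_x] assms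
  by auto

lemma integrals:
  assumes t: "t \<in> J"
  shows "(ux t has_integral 0) {0..1}" "((\<lambda>x. u t x * ux t x) has_integral 0) {0..1}"
    "((\<lambda>x. u t x) has_integral mean (u t)) {0..1}"
    "((\<lambda>x. (ux t x)\<^sup>2) has_integral E t) {0..1}" "((\<lambda>x. ux t x ^ 3) has_integral V t) {0..1}"
    "((\<lambda>x. ux t x ^ 4) has_integral Q t) {0..1}"
    "((\<lambda>x. q t x) has_integral 0) {0..1}" "((\<lambda>x. f t x) has_integral mean (f t)) {0..1}"
proof -
  have per: "u t 1 = u t 0" using u_per[OF t, of 0] by simp
  show "(ux t has_integral 0) {0..1}" using FTC_unit[OF u_x[OF t]] per by simp
  have "((\<lambda>x. (u t x)\<^sup>2 / 2) has_real_derivative u t x * ux t x) (at x)" for x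
    using u_x[OF t, of x] by (auto intro!: derivative_eq_intros)
  from FTC_unit[OF this] show "((\<lambda>x. u t x * ux t x) has_integral 0) {0..1}" using per by simp
  show "((\<lambda>x. q t x) has_integral 0) {0..1}"
    using q_mean[OF t] integrable_integral[OF integrable_continuous_real[OF sections(4)[OF t]]] by metis
  show "((\<lambda>x. u t x) has_integral mean (u t)) {0..1}"
    "((\<lambda>x. (ux t x)\<^sup>2) has_integral E t) {0..1}" "((\<lambda>x. ux t x ^ 3) has_integral V t) {0..1}"
    "((\<lambda>x. ux t x ^ 4) has_integral Q t) {0..1}" "((\<lambda>x. f t x) has_integral mean (f t)) {0..1}"
    unfolding mean_def E_def V_def Q_def f_def
    by (intro integrable_integral integrable_continuous_real continuous_intros t; simp)+
qed

lemma E_nonneg: "t \<in> J \<Longrightarrow> E t \<ge> 0"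
  using has_integral_nonneg[OF integrals(4)] by simp

lemma Q_nonneg: "t \<in> J \<Longrightarrow> Q t \<ge> 0"
  using has_integral_nonneg[OF integrals(6)] by simp

lemma mean_f:
  assumes t: "t \<in> J"
  shows "mean (f t) = 2 * m0 * exp (- lam * t) * mean (u t) + E t / 2"
proof -
  have "((\<lambda>x. f t x) has_integral 2 * m0 * exp (- lam * t) * mean (u t) + E t / 2) {0..1}"
    unfolding f_def
    by (intro has_integral_add has_integral_mult_right has_integral_divide integrals t)
  then show ?thesis using integrals(8)[OF t] has_integral_unique by blast
qed

lemma mean_decay:
  assumes t: "t \<in> J"
  shows "mean (u t) = m0 * exp (- lam * t)"
proof -
  have d: "((\<lambda>t. mean (u t)) has_real_derivative - lam * mean (u t)) (at t within {0..a})" if "t \<in> {0..a}" for t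
  proof -
    have tJ: "t \<in> J" using that by (simp add: J_def)
    have "((\<lambda>\<tau>. integral (cbox 0 1) (\<lambda>x. u \<tau> x)) has_field_derivative integral (cbox 0 1) (v t)) (at t within J)"
    proof (rule leibniz_rule_field_derivative)
      show "continuous_on (J \<times> cbox 0 1) (\<lambda>(t, x). v t x)"
        using cv unfolding split_beta by (rule continuous_on_subset) auto
      show "u t integrable_on cbox 0 1" if "t \<in> J" for t
        using sections(1)[OF that] by (auto intro: integrable_continuous_real)
    qed (use u_t tJ in \<open>auto simp: J_def\<close>)
    moreover have "(v t has_integral - 0 - 0 - lam * mean (u t)) {0..1}"
    proof -
      have "((\<lambda>x. - (u t x * ux t x) - q t x - lam * u t x) has_integral - 0 - 0 - lam * mean (u t)) {0..1}"
        by (intro has_integral_diff has_integral_neg has_integral_mult_right integrals tJ)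
      then show ?thesis by (simp add: eq[OF tJ, abs_def])
    qed
    ultimately show ?thesis by (simp add: mean_def integral_unique J_def)
  qed
  have "mean (u t) = mean (u 0) * exp (- lam * t)"
    by (rule linear_decay[where f = "\<lambda>t. mean (u t)" and a = a, OF d]) (use t J_def in auto)
  then show ?thesis by (simp only: m0)
qed

text \<open>
  Here the coefficient in \<open>f\<close> and the decay of the mean match: the first term of the mean of
  \<open>f\<close> becomes twice a square.
\<close>

lemma mean_f_nonneg:
  assumes t: "t \<in> J"
  shows "mean (f t) \<ge> 0"
proof -
  have "mean (f t) = 2 * (m0 * exp (- lam * t))\<^sup>2 + E t / 2"
    using mean_f[OF t] mean_decay[OF t] by (simp add: power2_eq_square)
  then show ?thesis using E_nonneg[OF t] by simp
qed

lemma moment_evolution: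
  assumes t: "t \<in> J"
  shows "((\<lambda>t. integral {0..1} (\<lambda>x. ux t x ^ Suc k)) has_real_derivative
     - real k * integral {0..1} (\<lambda>x. ux t x ^ (k + 2))
     + real (Suc k) * integral {0..1} (\<lambda>x. ux t x ^ k * (f t x - mean (f t) - lam * ux t x))) (at t within J)"
  unfolding J_def
proof (rule moment_derivative[where u = u and v = v and G = "\<lambda>t x. - q t x - lam * u t x"])
  have cf: "continuous_on (J \<times> UNIV) (\<lambda>p. f (fst p) (snd p))"
    unfolding f_def by (intro continuous_intros cu cux) auto
  have "continuous_on J (\<lambda>t. integral (cbox 0 1) (f t))"
    by (rule integral_continuous_on_param, unfold split_beta, rule continuous_on_subset[OF cf]) auto
  then have "continuous_on J (\<lambda>t. mean (f t))" by (simp add: mean_def)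
  then have "continuous_on (J \<times> (UNIV :: real set)) (\<lambda>p. mean (f (fst p)))"
    by (rule continuous_on_compose2) (auto intro: continuous_intros)
  then have "continuous_on (J \<times> UNIV) (\<lambda>p. f (fst p) (snd p) - mean (f (fst p)) - lam * ux (fst p) (snd p))"
    by (intro continuous_intros cf cux)
  then show "continuous_on ({0..a} \<times> UNIV) (\<lambda>p. f (fst p) (snd p) - mean (f (fst p)) - lam * ux (fst p) (snd p))"
    by (simp add: J_def)
  fix t x assume "t \<in> {0..a}"
  then have tJ: "t \<in> J" by (simp add: J_def)
  show "((\<lambda>x. - q t x - lam * u t x) has_real_derivative f t x - mean (f t) - lam * ux t x) (at x)"
    using q_x[OF tJ, of x] u_x[OF tJ, of x] by (auto intro!: derivative_eq_intros)
  show "v t x = - u t x * ux t x + (- q t x - lam * u t x)" using eq[OF tJ] by simp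
qed (use cu cux cv u_per u_x u_t t in \<open>auto simp: J_def\<close>)

text \<open>
  The cubic terms from transport and from the source cancel, and the remaining ones are
  derivatives of periodic functions, except for the damping.
\<close>

lemma energy_decay:
  assumes t: "t \<in> J"
  shows "E t = E 0 * exp (- (2 * lam) * t)"
proof -
  have d: "(E has_real_derivative - (2 * lam) * E t) (at t within {0..a})" if "t \<in> {0..a}" for t
  proof -
    have tJ: "t \<in> J" using that by (simp add: J_def)
    have "((\<lambda>x. 2 * m0 * exp (- lam * t) * (u t x * ux t x) + ux t x ^ 3 / 2 - mean (f t) * ux t x - lam * (ux t x)\<^sup>2)
        has_integral 2 * m0 * exp (- lam * t) * 0 + V t / 2 - mean (f t) * 0 - lam * E t) {0..1}"
      by (intro has_integral_add has_integral_diff has_integral_mult_right has_integral_divide integrals tJ)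
    moreover have "2 * m0 * exp (- lam * t) * (u t x * ux t x) + ux t x ^ 3 / 2 - mean (f t) * ux t x - lam * (ux t x)\<^sup>2
       = ux t x ^ 1 * (f t x - mean (f t) - lam * ux t x)" for x
      by (simp add: f_def power2_eq_square power3_eq_cube algebra_simps)
    ultimately have I: "integral {0..1} (\<lambda>x. ux t x ^ 1 * (f t x - mean (f t) - lam * ux t x)) = V t / 2 - lam * E t"
      by (simp add: integral_unique)
    have "((\<lambda>t. integral {0..1} (\<lambda>x. ux t x ^ Suc 1)) has_real_derivative - real 1 * V t + real (Suc 1) * (V t / 2 - lam * E t)) (at t within J)"
      using moment_evolution[OF tJ, of 1] unfolding I by (simp add: V_def numeral_3_eq_3)
    then show ?thesis by (simp add: E_def [abs_def] J_def numeral_2_eq_2 mult.assoc)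
  qed
  show ?thesis by (rule linear_decay[where f = E and a = a, OF d]) (use t J_def in auto)
qed

lemma energy_le: "t \<in> J \<Longrightarrow> E t \<le> E 0"
  using energy_decay[of t] E_nonneg[OF zero_in_J] lam
  by (auto simp: J_def intro!: mult_left_le)

lemma third_moment_evolution:
  assumes t: "t \<in> J"
  shows "(V has_real_derivative - Q t / 2 + 6 * m0 * exp (- lam * t) * integral {0..1} (\<lambda>x. u t x * (ux t x)\<^sup>2)
     - 3 * mean (f t) * E t - 3 * lam * V t) (at t within J)"
proof -
  define R where "R = integral {0..1} (\<lambda>x. u t x * (ux t x)\<^sup>2)"
  have hR: "((\<lambda>x. u t x * (ux t x)\<^sup>2) has_integral R) {0..1}"
    unfolding R_def by (intro integrable_integral integrable_continuous_real continuous_intros t)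
  have "((\<lambda>x. 2 * m0 * exp (- lam * t) * (u t x * (ux t x)\<^sup>2) + ux t x ^ 4 / 2 - mean (f t) * (ux t x)\<^sup>2 - lam * ux t x ^ 3)
      has_integral 2 * m0 * exp (- lam * t) * R + Q t / 2 - mean (f t) * E t - lam * V t) {0..1}"
    by (intro has_integral_add has_integral_diff has_integral_mult_right has_integral_divide integrals t hR)
  moreover have "2 * m0 * exp (- lam * t) * (u t x * (ux t x)\<^sup>2) + ux t x ^ 4 / 2 - mean (f t) * (ux t x)\<^sup>2 - lam * ux t x ^ 3
     = (ux t x)\<^sup>2 * (f t x - mean (f t) - lam * ux t x)" for x
    by (simp add: f_def power2_eq_square power3_eq_cube power4_eq_xxxx algebra_simps)
  ultimately have I: "integral {0..1} (\<lambda>x. (ux t x)\<^sup>2 * (f t x - mean (f t) - lam * ux t x))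
      = 2 * m0 * exp (- lam * t) * R + Q t / 2 - mean (f t) * E t - lam * V t"
    by (simp add: integral_unique)
  have "((\<lambda>t. integral {0..1} (\<lambda>x. ux t x ^ Suc 2)) has_real_derivative
      - real 2 * Q t + real (Suc 2) * (2 * m0 * exp (- lam * t) * R + Q t / 2 - mean (f t) * E t - lam * V t)) (at t within J)"
    using moment_evolution[OF t, of 2] unfolding I by (simp add: Q_def)
  then show ?thesis by (simp add: V_def [abs_def] R_def algebra_simps)
qed

lemma sup_bound:
  assumes t: "t \<in> J"
  shows "\<bar>u t x\<bar> \<le> \<bar>m0\<bar> + sqrt 3 / 6 * sqrt (E 0)"
proof -
  have "\<bar>u t x - mean (u t)\<bar> \<le> sqrt 3 / 6 * sqrt (E t)"
    unfolding E_def
    by (rule deviation_from_mean_bound) (use u_x u_per ux_per t in \<open>auto intro: continuous_intros\<close>)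
  also have "\<dots> \<le> sqrt 3 / 6 * sqrt (E 0)"
    using energy_le[OF t] by (intro mult_left_mono real_sqrt_le_mono) auto
  finally have "\<bar>u t x\<bar> \<le> \<bar>mean (u t)\<bar> + sqrt 3 / 6 * sqrt (E 0)" by linarith
  moreover have "\<bar>mean (u t)\<bar> \<le> \<bar>m0\<bar>"
    using mean_decay[OF t] t lam by (simp add: abs_mult J_def mult_left_le)
  ultimately show ?thesis by linarith
qed

text \<open>
  Cauchy-Schwarz for \<open>u\<^sub>x\<^sup>3 = u\<^sub>x u\<^sub>x\<^sup>2\<close> bounds the fourth moment from below, where \<open>E t \<le> E
  0\<close> makes the coefficient independent of time. All decaying exponentials in the \<open>u u\<^sub>x\<^sup>2\<close>
  term are bounded by \<open>1\<close>, and the term with the mean of \<open>f\<close> has a favourable sign.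
\<close>

theorem third_moment_inequality:
  assumes t: "t \<in> J" and m: "E 0 > 0"
  defines "K \<equiv> 6 * \<bar>m0\<bar> * E 0 * (\<bar>m0\<bar> + sqrt 3 / 6 * sqrt (E 0))"
  shows "- Q t / 2 + 6 * m0 * exp (- lam * t) * integral {0..1} (\<lambda>x. u t x * (ux t x)\<^sup>2)
     - 3 * mean (f t) * E t - 3 * lam * V t \<le> - (V t)\<^sup>2 / (2 * E 0) - 3 * lam * V t + K"
proof -
  define R where "R = integral {0..1} (\<lambda>x. u t x * (ux t x)\<^sup>2)"
  define B where "B = \<bar>m0\<bar> + sqrt 3 / 6 * sqrt (E 0)"
  have B0: "B \<ge> 0" using E_nonneg[OF zero_in_J] by (simp add: B_def)
  have "(V t)\<^sup>2 \<le> E t * Q t"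
  proof -
    have "(integral {0..1} (\<lambda>x. ux t x * (ux t x)\<^sup>2))\<^sup>2 \<le> integral {0..1} (\<lambda>x. (ux t x)\<^sup>2) * integral {0..1} (\<lambda>x. ((ux t x)\<^sup>2)\<^sup>2)"
      by (intro integral_Cauchy_Schwarz continuous_intros t)
    then show ?thesis by (simp add: V_def E_def Q_def power2_eq_square power3_eq_cube power4_eq_xxxx mult.assoc)
  qed
  also have "\<dots> \<le> E 0 * Q t" using energy_le[OF t] Q_nonneg[OF t] by (intro mult_right_mono)
  finally have "(V t)\<^sup>2 / (2 * E 0) \<le> Q t / 2" using m by (simp add: field_simps)
  moreover have "6 * m0 * exp (- lam * t) * R \<le> K"
  proof -
    have "norm R \<le> integral {0..1} (\<lambda>x. B * (ux t x)\<^sup>2)"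
      unfolding R_def
    proof (rule integral_norm_bound_integral)
      show "norm (u t x * (ux t x)\<^sup>2) \<le> B * (ux t x)\<^sup>2" for x
        using sup_bound[OF t, of x] by (auto simp: abs_mult B_def intro!: mult_right_mono)
    qed (auto intro!: integrable_continuous_real continuous_intros t)
    also have "\<dots> = B * E t" by (simp add: E_def)
    also have "\<dots> \<le> B * E 0" using energy_le[OF t] B0 by (intro mult_left_mono)
    finally have "\<bar>R\<bar> \<le> B * E 0" by simp
    have "\<bar>m0 * exp (- lam * t)\<bar> \<le> \<bar>m0\<bar>" using t lam by (simp add: abs_mult J_def mult_left_le)
    have "m0 * exp (- lam * t) * R \<le> \<bar>m0 * exp (- lam * t)\<bar> * \<bar>R\<bar>" by (metis abs_ge_self abs_mult)
    also have "\<dots> \<le> \<bar>m0\<bar> * (B * E 0)" using \<open>\<bar>m0 * exp (- lam * t)\<bar> \<le> \<bar>m0\<bar>\<close> \<open>\<bar>R\<bar> \<le> B * E 0\<close>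
      by (intro mult_mono) auto
    finally have "6 * (m0 * exp (- lam * t) * R) \<le> 6 * (\<bar>m0\<bar> * (B * E 0))" by simp
    moreover have "6 * (\<bar>m0\<bar> * (B * E 0)) = K" by (simp only: K_def B_def mult_ac)
    ultimately show ?thesis by (simp only: mult.assoc)
  qed
  moreover have "0 \<le> mean (f t) * E t" using mean_f_nonneg[OF t] E_nonneg[OF t] by simp
  ultimately show ?thesis unfolding R_def by linarith
qed

theorem lifespan_bound:
  assumes m: "E 0 > 0"
  defines "K \<equiv> 6 * \<bar>m0\<bar> * E 0 * (\<bar>m0\<bar> + sqrt 3 / 6 * sqrt (E 0))"
  defines "r \<equiv> - 3 * lam * E 0 - sqrt (9 * lam\<^sup>2 * (E 0)\<^sup>2 + 2 * K * E 0)"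
  assumes V0: "V 0 < r"
  shows "a < 2 * E 0 / (r - V 0)"
proof (rule riccati_lifespan)
  show "(V has_real_derivative - Q t / 2 + 6 * m0 * exp (- lam * t) * integral {0..1} (\<lambda>x. u t x * (ux t x)\<^sup>2)
     - 3 * mean (f t) * E t - 3 * lam * V t) (at t within {0..a})" if "t \<in> {0..a}" for t
    using third_moment_evolution[of t] that by (simp add: J_def)
  show "- Q t / 2 + 6 * m0 * exp (- lam * t) * integral {0..1} (\<lambda>x. u t x * (ux t x)\<^sup>2)
     - 3 * mean (f t) * E t - 3 * lam * V t \<le> - (V t)\<^sup>2 / (2 * E 0) - 3 * lam * V t + K" if "t \<in> {0..a}" for t
    unfolding K_def using third_moment_inequality[OF _ m, of t] that by (simp add: J_def)
  show "K \<ge> 0" using m by (simp add: K_def)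
  show "r = - 3 * lam * E 0 - sqrt (9 * lam\<^sup>2 * (E 0)\<^sup>2 + 2 * K * E 0)" by (simp add: r_def)
qed (use m a0 V0 in auto)

end

section \<open>From Sobolev solutions to blow-up\<close>

lemma sobolev_diff:
  assumes "f \<in> sobolev r" "g \<in> sobolev r"
  shows "(\<lambda>x. f x - g x) \<in> sobolev r"
  using sobolev_lincomb[OF assms, of 1 "-1"] by simp

lemma sobolev_scale:
  assumes "f \<in> sobolev r"
  shows "(\<lambda>x. c * f x) \<in> sobolev r"
  using sobolev_lincomb[OF assms assms, of c 0] by simp

lemma sobolev_continuous_joint:
  assumes u: "sobolev_continuous_on r J u" and r: "r > 1/2"
  shows "continuous_on (J \<times> UNIV) (\<lambda>p. u (fst p) (snd p))"
proof (rule joint_continuity[where N = "\<lambda>t \<tau>. embed_const r * sobolev_norm r (\<lambda>x. u \<tau> x - u t x)"])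
  show "((\<lambda>\<tau>. embed_const r * sobolev_norm r (\<lambda>x. u \<tau> x - u t x)) \<longlongrightarrow> 0) (at t within J)" if "t \<in> J" for t
    using u that by (intro tendsto_mult_right_zero) (auto simp: sobolev_continuous_on_def)
  show "\<bar>u \<tau> y - u t y\<bar> \<le> embed_const r * sobolev_norm r (\<lambda>x. u \<tau> x - u t x)" if "t \<in> J" "\<tau> \<in> J" for t \<tau> y
    using u that sobolev_sup_bound[OF sobolev_diff[of "u \<tau>" r "u t"] r] by (auto simp: sobolev_continuous_on_def)
  show "continuous_on UNIV (u t)" if "t \<in> J" for t
    using u that by (auto simp: sobolev_continuous_on_def intro: sobolevD)
qed

text \<open>
  The norm of \<open>H\<^sup>r\<close> with \<open>r > 3/2\<close> also controls the supremum of the derivative.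
\<close>

lemma sobolev_continuous_deriv_joint:
  assumes u: "sobolev_continuous_on r J u" and r: "r > 3/2"
  shows "continuous_on (J \<times> UNIV) (\<lambda>p. deriv (u (fst p)) (snd p))"
proof (rule joint_continuity[where u = "\<lambda>t. deriv (u t)" and
      N = "\<lambda>t \<tau>. embed_const (r - 1) * (2 * pi * sobolev_norm r (\<lambda>x. u \<tau> x - u t x))"])
  have uS: "u t \<in> sobolev r" if "t \<in> J" for t using u that by (auto simp: sobolev_continuous_on_def)
  show "((\<lambda>\<tau>. embed_const (r - 1) * (2 * pi * sobolev_norm r (\<lambda>x. u \<tau> x - u t x))) \<longlongrightarrow> 0) (at t within J)" if "t \<in> J" for t
    using u that by (intro tendsto_mult_right_zero) (auto simp: sobolev_continuous_on_def)
  show "\<bar>deriv (u \<tau>) y - deriv (u t) y\<bar> \<le> embed_const (r - 1) * (2 * pi * sobolev_norm r (\<lambda>x. u \<tau> x - u t x))"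
    if "t \<in> J" "\<tau> \<in> J" for t \<tau> y
  proof -
    let ?d = "\<lambda>x. u \<tau> x - u t x"
    have dS: "?d \<in> sobolev r" using uS that sobolev_diff by blast
    have "deriv ?d y = deriv (u \<tau>) y - deriv (u t) y"
      by (intro DERIV_imp_deriv DERIV_diff sobolev_has_derivative[OF uS r] that)
    moreover have "\<bar>deriv ?d y\<bar> \<le> embed_const (r - 1) * sobolev_norm (r - 1) (deriv ?d)"
      using sobolev_sup_bound[OF sobolev_deriv[OF dS r]] r by simp
    moreover have "\<dots> \<le> embed_const (r - 1) * (2 * pi * sobolev_norm r ?d)"
      by (intro mult_left_mono sobolev_norm_deriv[OF dS r] embed_const_nonneg)
    ultimately show ?thesis by simp
  qed
  show "continuous_on UNIV (deriv (u t))" if "t \<in> J" for t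
    using sobolevD(1)[OF sobolev_deriv[OF uS[OF that] r]] .
qed

lemma sobolev_has_derivative_pointwise:
  assumes u: "sobolev_has_derivative_on r J u v" and r: "r > 1/2" and t: "t \<in> J"
  shows "((\<lambda>\<tau>. u \<tau> x) has_real_derivative v t x) (at t within J)"
proof -
  have S: "u t \<in> sobolev r" "v t \<in> sobolev r" if "t \<in> J" for t
    using u that by (auto simp: sobolev_has_derivative_on_def)
  have lim: "((\<lambda>\<tau>. embed_const r * sobolev_norm r (\<lambda>x. (u \<tau> x - u t x) / (\<tau> - t) - v t x)) \<longlongrightarrow> 0) (at t within J)"
    using u t by (intro tendsto_mult_right_zero) (auto simp: sobolev_has_derivative_on_def)
  have "((\<lambda>\<tau>. (u \<tau> x - u t x) / (\<tau> - t) - v t x) \<longlongrightarrow> 0) (at t within J)"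
  proof (rule Lim_null_comparison[OF _ lim])
    have "norm ((u \<tau> x - u t x) / (\<tau> - t) - v t x) \<le> embed_const r * sobolev_norm r (\<lambda>x. (u \<tau> x - u t x) / (\<tau> - t) - v t x)"
      if "\<tau> \<in> J" for \<tau>
    proof -
      have "(\<lambda>x. (1 / (\<tau> - t)) * (u \<tau> x - u t x) - v t x) \<in> sobolev r"
        using that t by (intro sobolev_diff sobolev_scale S)
      then show ?thesis using sobolev_sup_bound[OF _ r] by simp
    qed
    then show "\<forall>\<^sub>F \<tau> in at t within J. norm ((u \<tau> x - u t x) / (\<tau> - t) - v t x) \<le> embed_const r * sobolev_norm r (\<lambda>x. (u \<tau> x - u t x) / (\<tau> - t) - v t x)"
      by (auto simp: eventually_at_filter)
  qed
  then show ?thesis unfolding has_field_derivative_iff by (rule Lim_null[THEN iffD2])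
qed

text \<open>
  The argument of \<open>A_inv\<close> lies in \<open>H\<^bsup>s-1\<^esup>\<close> because this space contains the squares of its
  elements; otherwise the value of \<open>A_inv\<close> would be arbitrary.
\<close>

lemma muHS_solution_classical:
  assumes lam: "lam > 0" and s: "s > 3/2" and sol: "muHS_solution lam s u0 T u"
    and a: "0 \<le> a" "ereal a < T"
  shows "\<exists>v q. muHS_classical lam a (mean u0) u (\<lambda>t. deriv (u t)) v q
     (\<lambda>t x. 2 * mean u0 * exp (- lam * t) * u t x + (deriv (u t) x)\<^sup>2 / 2) {0..a}"
proof -
  define f where "f t x = 2 * mean u0 * exp (- lam * t) * u t x + (deriv (u t) x)\<^sup>2 / 2" for t x
  from sol obtain v where uc: "sobolev_continuous_on s (time_interval T) u"
    and u0: "u 0 = u0" and vc: "sobolev_continuous_on (s - 1) (time_interval T) v"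
    and ud: "sobolev_has_derivative_on (s - 1) (time_interval T) u v"
    and eq: "\<And>t x. t \<in> time_interval T \<Longrightarrow> v t x + u t x * deriv (u t) x
        = - deriv (A_inv (s - 1) (f t)) x - lam * u t x"
    unfolding muHS_solution_def f_def by blast
  have J: "{0..a} \<subseteq> time_interval T"
    using a by (auto simp: time_interval_def) (meson ereal_less_eq(3) order.strict_trans1)
  have JU: "{0..a} \<times> (UNIV :: real set) \<subseteq> time_interval T \<times> UNIV" using J by auto
  have uS: "u t \<in> sobolev s" and uS': "u t \<in> sobolev (s - 1)" if "t \<in> {0..a}" for t
    using uc ud J that by (auto simp: sobolev_continuous_on_def sobolev_has_derivative_on_def)
  have s1: "s - 1 > 1/2" using s by simp
  have fS: "f t \<in> sobolev (s - 1)" if "t \<in> {0..a}" for t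
    using sobolev_lincomb[OF uS'[OF that] sobolev_square[OF sobolev_deriv[OF uS[OF that] s] s1],
        of "2 * mean u0 * exp (- lam * t)" "1/2"]
    by (simp add: f_def [abs_def])
  define q where "q t = deriv (A_inv (s - 1) (f t))" for t
  note A = A_inv_solves[OF fS s1]
  have "muHS_classical lam a (mean u0) u (\<lambda>t. deriv (u t)) v q f {0..a}"
  proof
    show "continuous_on ({0..a} \<times> UNIV) (\<lambda>p. u (fst p) (snd p))"
      using continuous_on_subset[OF sobolev_continuous_joint[OF uc] JU] s by simp
    show "continuous_on ({0..a} \<times> UNIV) (\<lambda>p. deriv (u (fst p)) (snd p))"
      using continuous_on_subset[OF sobolev_continuous_deriv_joint[OF uc s] JU] .
    show "continuous_on ({0..a} \<times> UNIV) (\<lambda>p. v (fst p) (snd p))"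
      using continuous_on_subset[OF sobolev_continuous_joint[OF vc s1] JU] .
    fix t x assume t: "t \<in> {0..a}"
    show "u t (x + 1) = u t x" "deriv (u t) (x + 1) = deriv (u t) x"
      using sobolevD(2)[OF uS[OF t]] sobolevD(2)[OF sobolev_deriv[OF uS[OF t] s]] by auto
    show "(u t has_real_derivative deriv (u t) x) (at x)"
      by (rule sobolev_has_derivative[OF uS[OF t] s])
    show "((\<lambda>\<tau>. u \<tau> x) has_real_derivative v t x) (at t within {0..a})"
      using sobolev_has_derivative_pointwise[OF ud s1] t J by (blast intro: DERIV_subset)
    show "(q t has_real_derivative mean (f t) - f t x) (at x)"
      unfolding q_def by (rule A(4)[OF t])
    show "v t x = - u t x * deriv (u t) x - q t x - lam * u t x"
      using eq[of t x] t J by (auto simp: q_def)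
  next
    fix t assume t: "t \<in> {0..a}"
    show "integral {0..1} (q t) = 0"
      using FTC_unit[OF A(2)[OF t]] A(1)[OF t, of 0] by (simp add: q_def integral_unique)
  next
    show "mean u0 = mean (u 0)" by (simp add: u0)
  qed (use lam a in \<open>auto simp: f_def fun_eq_iff\<close>)
  then show ?thesis unfolding f_def [abs_def] by blast
qed

theorem theorem4p1:
  fixes lam s mu0 mu1 K :: real and u0 :: "real \<Rightarrow> real"
  assumes "lam > 0"
    and "s > 3 / 2"
    and "u0 \<in> sobolev s"
    and "\<And>c. u0 \<noteq> (\<lambda>x. c)"
    and "mu0 = integral {0..1} u0"
    and "mu1 = sqrt (integral {0..1} (\<lambda>x. (deriv u0 x)\<^sup>2))"
    and "K = 6 * \<bar>mu0\<bar> * mu1\<^sup>2 * (\<bar>mu0\<bar> + sqrt 3 / 6 * mu1)"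
    and "integral {0..1} (\<lambda>x. (deriv u0 x) ^ 3)
           < - 3 * lam * mu1\<^sup>2 - mu1 * sqrt (9 * lam\<^sup>2 * mu1\<^sup>2 + 2 * K)"
  shows "blows_up_in_finite_time lam s u0"
proof -
  define m V0 where "m = integral {0..1} (\<lambda>x. (deriv u0 x)\<^sup>2)" and "V0 = integral {0..1} (\<lambda>x. (deriv u0 x) ^ 3)"
  have dc: "continuous_on {0..1} (deriv u0)"
    using sobolevD(1)[OF sobolev_deriv] assms(2,3) by blast
  have m0: "m \<ge> 0" unfolding m_def
    by (intro integral_nonneg integrable_continuous_real continuous_intros dc) auto
  have mu1: "mu1 = sqrt m" "mu1\<^sup>2 = m" using m0 by (auto simp: assms(6) m_def)
  \<comment> \<open>If the energy vanished, so would the third moment, against the strict inequality assumed for it.\<close>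
  have "m \<noteq> 0"
  proof
    assume "m = 0"
    then have "deriv u0 x = 0" if "x \<in> {0..1}" for x
      using integral_continuous_nonneg_eq_0[of "\<lambda>x. (deriv u0 x)\<^sup>2" x] that dc
      by (auto simp: m_def intro: continuous_intros)
    then have "V0 = integral {0..1} (\<lambda>x::real. 0::real)" unfolding V0_def by (intro integral_cong) simp
    then show False using assms(8) \<open>m = 0\<close> mu1 by (simp add: V0_def)
  qed
  with m0 have m: "m > 0" by simp
  have mK: "K = 6 * \<bar>mu0\<bar> * m * (\<bar>mu0\<bar> + sqrt 3 / 6 * sqrt m)" using assms(7) mu1 by simp
  define r where "r = - 3 * lam * m - sqrt (9 * lam\<^sup>2 * m\<^sup>2 + 2 * K * m)"
  have e: "mu1 * sqrt (9 * lam\<^sup>2 * mu1\<^sup>2 + 2 * K) = sqrt (9 * lam\<^sup>2 * m\<^sup>2 + 2 * K * m)"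
    unfolding mu1(2) unfolding mu1(1) real_sqrt_mult [symmetric] by (simp add: power2_eq_square algebra_simps)
  have V0r: "V0 < r" using assms(8) unfolding e unfolding mu1(2) V0_def r_def .
  have mu0: "mu0 = mean u0" by (simp add: assms(5) mean_def)
  define b where "b = 2 * m / (r - V0)"
  have b0: "b \<ge> 0" using m V0r by (simp add: b_def)
  \<comment> \<open>A solution beyond time \<open>b\<close> restricts to \<open>[0,b]\<close>, and the lifespan bound then reads \<open>b < b\<close>.\<close>
  have "T \<le> ereal b" if sol: "muHS_solution lam s u0 T u" for T u
  proof (rule ccontr)
    assume "\<not> T \<le> ereal b"
    then have "ereal b < T" by simp
    then obtain v q where "muHS_classical lam b (mean u0) u (\<lambda>t. deriv (u t)) v q
     (\<lambda>t x. 2 * mean u0 * exp (- lam * t) * u t x + (deriv (u t) x)\<^sup>2 / 2) {0..b}"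
      using muHS_solution_classical[OF assms(1,2) sol b0] by blast
    then interpret muHS_classical lam b "mean u0" u "\<lambda>t. deriv (u t)" v q
      "\<lambda>t x. 2 * mean u0 * exp (- lam * t) * u t x + (deriv (u t) x)\<^sup>2 / 2" "{0..b}" .
    have "u 0 = u0" using sol by (simp add: muHS_solution_def)
    then have E0: "E 0 = m" and V0: "V 0 = V0" by (auto simp: E_def V_def m_def V0_def)
    have "b < 2 * m / (r - V0)"
      by (rule lifespan_bound[unfolded E0 V0, folded mu0, folded mK, folded r_def, OF m V0r])
    then show False by (simp add: b_def)
  qed
  then have "max_existence_time lam s u0 \<le> ereal b"
    unfolding max_existence_time_def by (intro Sup_least) auto
  also have "\<dots> < \<infinity>" by simp
  finally show ?thesis unfolding blows_up_in_finite_time_def .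
qed

end
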